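(* Let $(\Omega,\mathcal F,\mu)$ be a probability space, let $(\mathcal E,\mathcal D(\mathcal E))$ be a conservative symmetric Dirichlet form on $L^2(\mu)$ with associated Markov semigroup $(P_t)_{t\ge0}$ and generator $(L,\mathcal D(L))$, let $p\in[1,2]$, and let $\alpha:(0,\infty)\to(0,\infty)$ be measurable with $$\int_1^\infty\frac{\alpha(r)}{r}\,dr<\infty.$$ Assume that $$\Psi_p(f)\le\alpha(r)\,\mathcal E(f,f)+r\,\mathrm{Osc}(f)^2,\qquad r>0,$$ for every bounded non-negative $f\in\mathcal D(\mathcal E)$. Then $$\Psi_p\big((P_tf)^{1/p}\big)\le\xi(t)\,\mathrm{Osc}(f^{1/p})^2$$ for every $t>0$ and every bounded non-negative $f\in\mathcal D(L)$, where $$\xi(t):=\inf_{\epsilon\in(0,1)}\frac1\epsilon\,\eta^{-1}\big(2(1-\epsilon)t\big),\qquad \eta(t):=\int_t^\infty\frac{\alpha(r)}{r}\,dr,\quad t>0.$$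
   Context: A symmetric Dirichlet form $(\mathcal E,\mathcal D(\mathcal E))$ on $L^2(\mu)$ is called conservative if $1\in\mathcal D(\mathcal E)$ and $\mathcal E(1,1)=0$. For a non-negative $f\in L^2(\mu)$ and $1\le p<2$, with $\mu(g):=\int g\,d\mu$, $$\Psi_p(f):=\frac{\mu(f^2)-\mu(f^p)^{2/p}}{2-p},$$ and $\Psi_2(f):=\tfrac12\mathrm{Ent}_\mu(f^2)$, where $\mathrm{Ent}_\mu(f^2)=\mu(f^2\log f^2)-\mu(f^2)\log\mu(f^2)$ (convention $0\log 0=0$). For bounded $f$, $\mathrm{Osc}(f):=\operatorname{ess\,sup}f-\operatorname{ess\,inf}f$. The inverse of the non-increasing function $\eta$ is the generalized inverse $\eta^{-1}(u):=\inf\{t>0:\eta(t)\le u\}$, $u>0$. *)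

theory Defs
  imports "HOL-Probability.Probability"
begin

section \<open>The space $L^2(\mu)$\<close>

text \<open>
  Elements of $L^2(\mu)$ are represented by square-integrable functions; all notions below are
  invariant under (or stated up to) almost everywhere equality.
\<close>

definition L2 :: "'a measure \<Rightarrow> ('a \<Rightarrow> real) set" where
  "L2 M = {f \<in> borel_measurable M. integrable M (\<lambda>x. (f x)\<^sup>2)}"

definition L2_norm :: "'a measure \<Rightarrow> ('a \<Rightarrow> real) \<Rightarrow> real" where
  "L2_norm M f = sqrt (\<integral>x. (f x)\<^sup>2 \<partial>M)"

definition ess_bounded :: "'a measure \<Rightarrow> ('a \<Rightarrow> real) \<Rightarrow> bool" where
  "ess_bounded M f \<longleftrightarrow> (\<exists>C. AE x in M. \<bar>f x\<bar> \<le> C)"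

text \<open>The dual of \<open>esssup\<close>, which is the only one of the two that the library provides.\<close>

definition essinf :: "'a measure \<Rightarrow> ('a \<Rightarrow> ereal) \<Rightarrow> ereal" where
  "essinf M f = (if f \<in> borel_measurable M then Liminf (ae_filter M) f else bot)"

text \<open>Meaningful for essentially bounded measurable functions on a non-null space, where both
  extended reals are finite.\<close>

definition Osc :: "'a measure \<Rightarrow> ('a \<Rightarrow> real) \<Rightarrow> real" where
  "Osc M f = real_of_ereal (esssup M (\<lambda>x. ereal (f x)) - essinf M (\<lambda>x. ereal (f x)))"


section \<open>Symmetric Dirichlet forms\<close>

locale symmetric_dirichlet_form =
  fixes M :: "'a measure"
    and D :: "('a \<Rightarrow> real) set"
    and E :: "('a \<Rightarrow> real) \<Rightarrow> ('a \<Rightarrow> real) \<Rightarrow> real"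
  assumes domain_L2: "D \<subseteq> L2 M"
    and domain_AE_cong: "\<And>f g. f \<in> D \<Longrightarrow> g \<in> borel_measurable M \<Longrightarrow> AE x in M. f x = g x \<Longrightarrow> g \<in> D"
    and form_AE_cong: "\<And>f g h. f \<in> D \<Longrightarrow> g \<in> D \<Longrightarrow> h \<in> D \<Longrightarrow> AE x in M. f x = g x \<Longrightarrow> E f h = E g h"
    and domain_zero: "(\<lambda>_. 0) \<in> D"
    and domain_add: "\<And>f g. f \<in> D \<Longrightarrow> g \<in> D \<Longrightarrow> (\<lambda>x. f x + g x) \<in> D"
    and domain_scale: "\<And>f c. f \<in> D \<Longrightarrow> (\<lambda>x. c * f x) \<in> D"
    and domain_dense: "\<And>f e. f \<in> L2 M \<Longrightarrow> 0 < e \<Longrightarrow> \<exists>g\<in>D. L2_norm M (\<lambda>x. f x - g x) < e"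
    and form_add: "\<And>f g h. f \<in> D \<Longrightarrow> g \<in> D \<Longrightarrow> h \<in> D \<Longrightarrow> E (\<lambda>x. f x + g x) h = E f h + E g h"
    and form_scale: "\<And>f h c. f \<in> D \<Longrightarrow> h \<in> D \<Longrightarrow> E (\<lambda>x. c * f x) h = c * E f h"
    and form_sym: "\<And>f g. f \<in> D \<Longrightarrow> g \<in> D \<Longrightarrow> E f g = E g f"
    and form_nonneg: "\<And>f. f \<in> D \<Longrightarrow> 0 \<le> E f f"
    \<comment> \<open>closedness: \<open>D\<close> is complete for the norm $(\mathcal E(f,f) + \|f\|_2^2)^{1/2}$\<close>
    and form_closed: "\<And>u. (\<And>n::nat. u n \<in> D) \<Longrightarrow>
        (\<And>e. 0 < e \<Longrightarrow> \<exists>N. \<forall>m\<ge>N. \<forall>n\<ge>N.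
            E (\<lambda>x. u m x - u n x) (\<lambda>x. u m x - u n x)
              + (L2_norm M (\<lambda>x. u m x - u n x))\<^sup>2 < e) \<Longrightarrow>
        \<exists>v\<in>D. (\<lambda>n. E (\<lambda>x. u n x - v x) (\<lambda>x. u n x - v x)
              + (L2_norm M (\<lambda>x. u n x - v x))\<^sup>2) \<longlonglongrightarrow> 0"
    \<comment> \<open>Markovianity: the unit contraction operates\<close>
    and unit_contraction_domain: "\<And>f. f \<in> D \<Longrightarrow> (\<lambda>x. min 1 (max 0 (f x))) \<in> D"
    and unit_contraction_form: "\<And>f. f \<in> D \<Longrightarrow>
        E (\<lambda>x. min 1 (max 0 (f x))) (\<lambda>x. min 1 (max 0 (f x))) \<le> E f f"

locale conservative_dirichlet_form = symmetric_dirichlet_form +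
  assumes one_in_domain: "(\<lambda>_. 1) \<in> D"
    and form_one: "E (\<lambda>_. 1) (\<lambda>_. 1) = 0"

text \<open>
  Graph of the operator of the form: $f$ is in its domain, with value $g$, iff
  $\mathcal E(f,h) = -\langle g,h\rangle$ for all $h$ in the domain of the form.
\<close>

definition form_operator ::
    "'a measure \<Rightarrow> ('a \<Rightarrow> real) set \<Rightarrow> (('a \<Rightarrow> real) \<Rightarrow> ('a \<Rightarrow> real) \<Rightarrow> real) \<Rightarrow>
     (('a \<Rightarrow> real) \<times> ('a \<Rightarrow> real)) set" where
  "form_operator M D E =
     {(f, g). f \<in> D \<and> g \<in> L2 M \<and> (\<forall>h\<in>D. E f h = - (\<integral>x. g x * h x \<partial>M))}"


section \<open>Markov semigroups and their generators\<close>

text \<open>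
  Strongly continuous contraction semigroups of Markovian operators on $L^2(\mu)$.  Only times
  $t \ge 0$ and arguments in $L^2(\mu)$ matter.
\<close>

locale markov_semigroup =
  fixes M :: "'a measure"
    and P :: "real \<Rightarrow> ('a \<Rightarrow> real) \<Rightarrow> ('a \<Rightarrow> real)"
  assumes semigroup_L2: "\<And>t f. 0 \<le> t \<Longrightarrow> f \<in> L2 M \<Longrightarrow> P t f \<in> L2 M"
    and semigroup_AE_cong: "\<And>t f g. 0 \<le> t \<Longrightarrow> f \<in> L2 M \<Longrightarrow> g \<in> L2 M \<Longrightarrow>
        AE x in M. f x = g x \<Longrightarrow> AE x in M. P t f x = P t g x"
    and semigroup_add: "\<And>t f g. 0 \<le> t \<Longrightarrow> f \<in> L2 M \<Longrightarrow> g \<in> L2 M \<Longrightarrow>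
        AE x in M. P t (\<lambda>x. f x + g x) x = P t f x + P t g x"
    and semigroup_scale: "\<And>t f c. 0 \<le> t \<Longrightarrow> f \<in> L2 M \<Longrightarrow>
        AE x in M. P t (\<lambda>x. c * f x) x = c * P t f x"
    and semigroup_zero: "\<And>f. f \<in> L2 M \<Longrightarrow> AE x in M. P 0 f x = f x"
    and semigroup_comp: "\<And>s t f. 0 \<le> s \<Longrightarrow> 0 \<le> t \<Longrightarrow> f \<in> L2 M \<Longrightarrow>
        AE x in M. P (s + t) f x = P s (P t f) x"
    and semigroup_contraction: "\<And>t f. 0 \<le> t \<Longrightarrow> f \<in> L2 M \<Longrightarrow> L2_norm M (P t f) \<le> L2_norm M f"
    and semigroup_continuous: "\<And>f. f \<in> L2 M \<Longrightarrow>
        ((\<lambda>t. L2_norm M (\<lambda>x. P t f x - f x)) \<longlongrightarrow> 0) (at_right 0)"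
    and semigroup_markovian: "\<And>t f. 0 \<le> t \<Longrightarrow> f \<in> L2 M \<Longrightarrow>
        AE x in M. 0 \<le> f x \<and> f x \<le> 1 \<Longrightarrow> AE x in M. 0 \<le> P t f x \<and> P t f x \<le> 1"

text \<open>Graph of the infinitesimal generator, $g = \lim_{t \to 0+} (P_t f - f)/t$ in $L^2(\mu)$.\<close>

definition generator ::
    "'a measure \<Rightarrow> (real \<Rightarrow> ('a \<Rightarrow> real) \<Rightarrow> ('a \<Rightarrow> real)) \<Rightarrow>
     (('a \<Rightarrow> real) \<times> ('a \<Rightarrow> real)) set" where
  "generator M P =
     {(f, g). f \<in> L2 M \<and> g \<in> L2 M \<and>
        ((\<lambda>t. L2_norm M (\<lambda>x. (P t f x - f x) / t - g x)) \<longlongrightarrow> 0) (at_right 0)}"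

text \<open>
  $(P_t)$ is associated with the form iff it is generated by the operator $L$ of the form, i.e.
  $P_t = e^{tL}$.  For a symmetric Dirichlet form exactly one such semigroup exists (up to null
  sets), and it is automatically Markovian.
\<close>

definition associated_markov_semigroup ::
    "'a measure \<Rightarrow> ('a \<Rightarrow> real) set \<Rightarrow> (('a \<Rightarrow> real) \<Rightarrow> ('a \<Rightarrow> real) \<Rightarrow> real) \<Rightarrow>
     (real \<Rightarrow> ('a \<Rightarrow> real) \<Rightarrow> ('a \<Rightarrow> real)) \<Rightarrow> bool" where
  "associated_markov_semigroup M D E P \<longleftrightarrow>
     markov_semigroup M P \<and> generator M P = form_operator M D E"


section \<open>The functionals $\Psi_p$ and the rate function\<close>

text \<open>The convention $0 \log 0 = 0$ holds because multiplication by zero gives zero.\<close>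

definition Ent :: "'a measure \<Rightarrow> ('a \<Rightarrow> real) \<Rightarrow> real" where
  "Ent M g = (\<integral>x. g x * ln (g x) \<partial>M) - (\<integral>x. g x \<partial>M) * ln (\<integral>x. g x \<partial>M)"

text \<open>
  Real-valued, hence meant for non-negative $f$ for which the integrals converge; on a probability
  space this covers every $f \in L^2(\mu)$ if $p < 2$ and every bounded $f$ if $p = 2$.
\<close>

definition Psi :: "'a measure \<Rightarrow> real \<Rightarrow> ('a \<Rightarrow> real) \<Rightarrow> real" where
  "Psi M p f =
     (if p = 2 then 1 / 2 * Ent M (\<lambda>x. (f x)\<^sup>2)
      else ((\<integral>x. (f x)\<^sup>2 \<partial>M) - (\<integral>x. f x powr p \<partial>M) powr (2 / p)) / (2 - p))"

text \<open>
  The integral may be infinite for small $t$, since $\alpha$ need not be integrable near points of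
  $(0,1]$; hence the extended non-negative value.
\<close>

definition eta :: "(real \<Rightarrow> real) \<Rightarrow> real \<Rightarrow> ennreal" where
  "eta \<alpha> t = (\<integral>\<^sup>+r\<in>{t<..}. ennreal (\<alpha> r / r) \<partial>lborel)"

definition generalized_inverse :: "(real \<Rightarrow> ennreal) \<Rightarrow> real \<Rightarrow> real" where
  "generalized_inverse \<eta> u = Inf {t. 0 < t \<and> \<eta> t \<le> ennreal u}"

definition xi :: "(real \<Rightarrow> real) \<Rightarrow> real \<Rightarrow> real" where
  "xi \<alpha> t = (INF \<epsilon>\<in>{0<..<1}. 1 / \<epsilon> * generalized_inverse (eta \<alpha>) (2 * (1 - \<epsilon>) * t))"

end

theory Submission
  imports Defs "HOL-Real_Asymp.Real_Asymp"
begin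

text \<open>
  Write \<open>v\<^sub>t = (P\<^sub>t f)\<^sup>1\<^sup>/\<^sup>p\<close>.  The quantity \<open>Psi M p v\<^sub>t\<close> is the Jensen gap of a convex function \<open>Phi p\<close> for
  \<open>P\<^sub>t f\<close>.  The semigroup preserves the mean, so the gap has time derivative \<open>- E (dPhi p (P\<^sub>t f)) (P\<^sub>t f)\<close>,
  where \<open>dPhi p\<close> is the derivative of \<open>Phi p\<close>.  As the second derivative of \<open>Phi p\<close> is twice the
  square of the derivative of \<open>y powr (1 / p)\<close>, the Stroock--Varopoulos inequality bounds this by
  \<open>- 2 * E v\<^sub>t v\<^sub>t\<close>.  The semigroup also preserves upper and lower bounds, so the oscillation of \<open>v\<^sub>t\<close>
  is at most that of \<open>v\<^sub>0\<close>, called \<open>osc\<close>.  The functional inequality with \<open>r = h t\<close>, where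
  \<open>h t = \<epsilon> * Psi M p v\<^sub>t / osc\<^sup>2\<close> is positive, then reads \<open>2 * (1 - \<epsilon>) * h \<le> - h' * \<alpha> h\<close>: along \<open>h\<close> the function
  \<open>eta \<alpha>\<close> grows at least at rate \<open>2 * (1 - \<epsilon>)\<close>.  Thus \<open>h t\<close> is at most the generalized inverse of
  \<open>eta \<alpha>\<close> at \<open>2 * (1 - \<epsilon>) * t\<close> (\<open>decay_le_generalized_inverse\<close>, \<open>entropy_decay\<close>), and it remains to
  optimise over \<open>\<epsilon>\<close>.

  The Stroock--Varopoulos inequality (\<open>Stroock_Varopoulos\<close>) is derived from the unit contraction alone,
  without spectral theory or transition kernels.  The function \<open>u\<close> is cut into horizontal slices; the
  mixed energies of distinct slices are non-negative, because adding a positive multiple of a higher slice to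
  a lower one does not change the unit contraction of the latter (\<open>form_saturated_nonneg\<close>).  For
  piecewise linear functions of \<open>u\<close> the inequality is then one between coefficients, and it passes to
  the limit by lower semicontinuity of the energy (\<open>form_lower_semicontinuous\<close>).

  Since \<open>dPhi p\<close> may be singular at 0, the argument is run for \<open>f + \<delta>\<close> with \<open>\<delta> > 0\<close>, and
  \<open>\<delta>\<close> tends to 0 at the end.
\<close>

section \<open>Square-integrable functions\<close>

lemma L2_measurable: "f \<in> L2 M \<Longrightarrow> f \<in> borel_measurable M"
  and L2_integrable_sq: "f \<in> L2 M \<Longrightarrow> integrable M (\<lambda>x. (f x)\<^sup>2)"
  by (auto simp: L2_def)

lemma L2_integrable_mult:
  assumes f: "f \<in> L2 M" and g: "g \<in> L2 M"
  shows "integrable M (\<lambda>x. f x * g x)"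
proof (rule Bochner_Integration.integrable_bound)
  show "integrable M (\<lambda>x. (f x)\<^sup>2 + (g x)\<^sup>2)"
    using f g by (simp add: L2_integrable_sq)
  show "(\<lambda>x. f x * g x) \<in> borel_measurable M"
    using f g by (intro borel_measurable_times L2_measurable)
  have "\<bar>a * b\<bar> \<le> a\<^sup>2 + b\<^sup>2" for a b :: real
  proof -
    have "0 \<le> (a + b)\<^sup>2" "0 \<le> (a - b)\<^sup>2" by simp_all
    moreover have "0 \<le> a\<^sup>2 + b\<^sup>2" by simp
    ultimately show ?thesis unfolding power2_sum power2_diff by linarith
  qed
  then show "AE x in M. norm (f x * g x) \<le> norm ((f x)\<^sup>2 + (g x)\<^sup>2)"
    by simp
qed

lemma L2_scale: "f \<in> L2 M \<Longrightarrow> (\<lambda>x. c * f x) \<in> L2 M"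
  by (auto simp: L2_def power_mult_distrib)

lemma L2_divide: "f \<in> L2 M \<Longrightarrow> (\<lambda>x. f x / c) \<in> L2 M"
  using L2_scale[of f M "1 / c"] by simp

lemma L2_add:
  assumes f: "f \<in> L2 M" and g: "g \<in> L2 M"
  shows "(\<lambda>x. f x + g x) \<in> L2 M"
proof -
  have "(f x + g x)\<^sup>2 = (f x)\<^sup>2 + (g x)\<^sup>2 + 2 * (f x * g x)" for x
    by (simp add: power2_sum)
  then have "integrable M (\<lambda>x. (f x + g x)\<^sup>2)"
    using L2_integrable_sq[OF f] L2_integrable_sq[OF g] L2_integrable_mult[OF f g] by simp
  then show ?thesis
    using f g by (auto simp: L2_def)
qed

lemma L2_diff:
  assumes f: "f \<in> L2 M" and g: "g \<in> L2 M"
  shows "(\<lambda>x. f x - g x) \<in> L2 M"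
  using L2_add[OF f L2_scale[OF g, of "-1"]] by simp

lemma L2_norm_nonneg: "0 \<le> L2_norm M f"
  by (simp add: L2_norm_def)

lemma L2_norm_square: "(L2_norm M f)\<^sup>2 = (\<integral>x. (f x)\<^sup>2 \<partial>M)"
  by (simp add: L2_norm_def)

lemma L2_norm_AE_cong:
  assumes "f \<in> borel_measurable M" "g \<in> borel_measurable M" "AE x in M. f x = g x"
  shows "L2_norm M f = L2_norm M g"
  unfolding L2_norm_def
  using assms by (intro arg_cong[where f = sqrt] integral_cong_AE) (auto elim!: eventually_mono)

lemma L2_norm_scale: "L2_norm M (\<lambda>x. c * f x) = \<bar>c\<bar> * L2_norm M f"
  by (simp add: L2_norm_def power_mult_distrib real_sqrt_mult)

lemma L2_norm_commute: "L2_norm M (\<lambda>x. f x - g x) = L2_norm M (\<lambda>x. g x - f x)"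
  by (simp add: L2_norm_def power2_commute)

lemma L2_norm_eq_0_AE:
  assumes "f \<in> L2 M" "L2_norm M f = 0"
  shows "AE x in M. f x = 0"
proof -
  have "(\<integral>x. (f x)\<^sup>2 \<partial>M) = 0"
    using assms(2) by (simp add: L2_norm_def)
  then show ?thesis
    using integral_nonneg_eq_0_iff_AE[OF L2_integrable_sq[OF assms(1)]] by simp
qed

text \<open>
  The discriminant argument is carried out for arbitrary quadratic forms, as it serves both the
  inner product of \<open>L2\<close> and a Dirichlet form.
\<close>

lemma discriminant_bound:
  fixes A B C :: real
  assumes "\<And>s. 0 \<le> A + 2 * s * B + s\<^sup>2 * C" and "0 \<le> A" and "0 \<le> C"
  shows "B\<^sup>2 \<le> A * C"
proof (cases "C = 0")
  case True
  have "B = 0"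
  proof (rule ccontr)
    assume "B \<noteq> 0"
    then have "A + 2 * (- (A + 1) / (2 * B)) * B = - 1" by (simp add: field_simps)
    with assms(1)[of "- (A + 1) / (2 * B)"] True show False by simp
  qed
  with True show ?thesis by simp
next
  case False
  then have "0 < C" using assms(3) by simp
  have "0 \<le> A + 2 * (- B / C) * B + (- B / C)\<^sup>2 * C" by (rule assms(1))
  also have "\<dots> = A - B\<^sup>2 / C"
    using \<open>0 < C\<close> by (simp add: field_simps power2_eq_square)
  finally have "B\<^sup>2 / C \<le> A" by simp
  then show ?thesis using \<open>0 < C\<close> by (simp add: field_simps)
qed

lemma L2_Cauchy_Schwarz:
  assumes f: "f \<in> L2 M" and g: "g \<in> L2 M"
  shows "\<bar>\<integral>x. f x * g x \<partial>M\<bar> \<le> L2_norm M f * L2_norm M g"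
proof -
  have "0 \<le> (\<integral>x. (f x)\<^sup>2 \<partial>M) + 2 * s * (\<integral>x. f x * g x \<partial>M) + s\<^sup>2 * (\<integral>x. (g x)\<^sup>2 \<partial>M)" for s
  proof -
    have "0 \<le> (\<integral>x. (f x + s * g x)\<^sup>2 \<partial>M)" by simp
    also have "\<dots> = (\<integral>x. (f x)\<^sup>2 + 2 * s * (f x * g x) + s\<^sup>2 * (g x)\<^sup>2 \<partial>M)"
      by (intro Bochner_Integration.integral_cong) (auto simp: power2_eq_square algebra_simps)
    also have "\<dots> = (\<integral>x. (f x)\<^sup>2 \<partial>M) + 2 * s * (\<integral>x. f x * g x \<partial>M) + s\<^sup>2 * (\<integral>x. (g x)\<^sup>2 \<partial>M)"
      using L2_integrable_sq[OF f] L2_integrable_sq[OF g] L2_integrable_mult[OF f g] by simp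
    finally show ?thesis .
  qed
  then have "(\<integral>x. f x * g x \<partial>M)\<^sup>2 \<le> (\<integral>x. (f x)\<^sup>2 \<partial>M) * (\<integral>x. (g x)\<^sup>2 \<partial>M)"
    by (intro discriminant_bound) auto
  then have "(\<integral>x. f x * g x \<partial>M)\<^sup>2 \<le> (L2_norm M f * L2_norm M g)\<^sup>2"
    by (simp add: power_mult_distrib L2_norm_square)
  then show ?thesis
    by (rule abs_le_square_iff[THEN iffD2, THEN order_trans]) (simp add: L2_norm_nonneg)
qed

lemma L2_norm_triangle:
  assumes f: "f \<in> L2 M" and g: "g \<in> L2 M"
  shows "L2_norm M (\<lambda>x. f x + g x) \<le> L2_norm M f + L2_norm M g"
proof (rule power2_le_imp_le)
  have "(L2_norm M (\<lambda>x. f x + g x))\<^sup>2 = (\<integral>x. (f x)\<^sup>2 + 2 * (f x * g x) + (g x)\<^sup>2 \<partial>M)"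
    unfolding L2_norm_square
    by (intro Bochner_Integration.integral_cong) (auto simp: power2_eq_square algebra_simps)
  also have "\<dots> = (L2_norm M f)\<^sup>2 + 2 * (\<integral>x. f x * g x \<partial>M) + (L2_norm M g)\<^sup>2"
    using L2_integrable_sq[OF f] L2_integrable_sq[OF g] L2_integrable_mult[OF f g]
    by (simp add: L2_norm_square)
  also have "\<dots> \<le> (L2_norm M f)\<^sup>2 + 2 * (L2_norm M f * L2_norm M g) + (L2_norm M g)\<^sup>2"
    using L2_Cauchy_Schwarz[OF f g] by linarith
  finally show "(L2_norm M (\<lambda>x. f x + g x))\<^sup>2 \<le> (L2_norm M f + L2_norm M g)\<^sup>2"
    by (simp add: power2_sum algebra_simps)
qed (simp add: L2_norm_nonneg)

lemma L2_norm_triangle3: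
  assumes "f \<in> L2 M" "g \<in> L2 M" "h \<in> L2 M"
  shows "L2_norm M (\<lambda>x. f x - h x) \<le> L2_norm M (\<lambda>x. f x - g x) + L2_norm M (\<lambda>x. g x - h x)"
  using L2_norm_triangle[of "\<lambda>x. f x - g x" M "\<lambda>x. g x - h x"] assms by (simp add: L2_diff)

lemma (in finite_measure) L2_bounded:
  assumes [measurable]: "f \<in> borel_measurable M" and bd: "AE x in M. \<bar>f x\<bar> \<le> C"
  shows "f \<in> L2 M"
proof -
  have "AE x in M. norm ((f x)\<^sup>2) \<le> C\<^sup>2"
    using bd by (auto elim!: eventually_mono simp flip: abs_le_square_iff)
  then have "integrable M (\<lambda>x. (f x)\<^sup>2)"
    by (intro integrable_const_bound[where B = "C\<^sup>2"]) auto
  then show ?thesis by (simp add: L2_def)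
qed

lemma (in finite_measure) L2_const: "(\<lambda>_. c) \<in> L2 M"
  by (rule L2_bounded[where C = "\<bar>c\<bar>"]) auto

lemma (in finite_measure) L2_integrable:
  assumes "f \<in> L2 M" shows "integrable M f"
  using L2_integrable_mult[OF assms L2_const[of 1]] by simp

lemma bounded_on_interval:
  fixes F :: "real \<Rightarrow> real"
  assumes "continuous_on {a..b} F"
  obtains C where "0 \<le> C" "\<And>y. a \<le> y \<Longrightarrow> y \<le> b \<Longrightarrow> \<bar>F y\<bar> \<le> C"
proof -
  have "bounded (F ` {a..b})"
    by (intro compact_imp_bounded compact_continuous_image assms) simp
  then obtain C where C: "\<And>y. y \<in> {a..b} \<Longrightarrow> \<bar>F y\<bar> \<le> C"
    unfolding bounded_iff by (metis imageI real_norm_def)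
  show ?thesis
  proof (rule that[of "\<bar>C\<bar>"])
    show "\<bar>F y\<bar> \<le> \<bar>C\<bar>" if "a \<le> y" "y \<le> b" for y
      using C[of y] that by auto
  qed simp
qed

lemma (in finite_measure) L2_continuous_composition:
  fixes G :: "real \<Rightarrow> real"
  assumes cont: "continuous_on {a..b} G" and G: "G \<in> borel_measurable borel"
    and u: "u \<in> borel_measurable M" and range: "AE x in M. a \<le> u x \<and> u x \<le> b"
  shows "(\<lambda>x. G (u x)) \<in> L2 M"
proof -
  obtain C where "\<And>y. a \<le> y \<Longrightarrow> y \<le> b \<Longrightarrow> \<bar>G y\<bar> \<le> C"
    using bounded_on_interval[OF cont] by blast
  then have "AE x in M. \<bar>G (u x)\<bar> \<le> C"
    by (intro eventually_mono[OF range]) auto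
  then show ?thesis by (intro L2_bounded measurable_compose[OF u G])
qed

lemma (in prob_space) L2_norm_le_sup:
  assumes [measurable]: "f \<in> borel_measurable M" and bd: "AE x in M. \<bar>f x\<bar> \<le> C" and "0 \<le> C"
  shows "L2_norm M f \<le> C"
proof -
  have "(\<integral>x. (f x)\<^sup>2 \<partial>M) \<le> (\<integral>x. C\<^sup>2 \<partial>M)"
  proof (rule integral_mono_AE)
    show "integrable M (\<lambda>x. (f x)\<^sup>2)" by (rule L2_integrable_sq[OF L2_bounded[OF assms(1) bd]])
    show "AE x in M. (f x)\<^sup>2 \<le> C\<^sup>2"
      using bd by (auto elim!: eventually_mono simp flip: abs_le_square_iff)
  qed simp
  also have "\<dots> = C\<^sup>2" by (simp add: prob_space)
  finally show ?thesis
    unfolding L2_norm_def using \<open>0 \<le> C\<close> by (rule real_le_lsqrt[OF _, rotated])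
qed

section \<open>Contractions and lower semicontinuity of the form\<close>

context symmetric_dirichlet_form
begin

lemma domain_diff: "f \<in> D \<Longrightarrow> g \<in> D \<Longrightarrow> (\<lambda>x. f x - g x) \<in> D"
  using domain_add[OF _ domain_scale[of g "-1"], of f] by simp

lemma domain_sum:
  assumes "finite I" and "\<And>i. i \<in> I \<Longrightarrow> f i \<in> D"
  shows "(\<lambda>x. \<Sum>i\<in>I. f i x) \<in> D"
  using assms by (induction I rule: finite_induct) (auto intro: domain_zero domain_add)

lemma form_add_right:
  "f \<in> D \<Longrightarrow> g \<in> D \<Longrightarrow> h \<in> D \<Longrightarrow> E h (\<lambda>x. f x + g x) = E h f + E h g"
  using form_add[of f g h] by (simp add: form_sym domain_add)

lemma form_scale_right: "f \<in> D \<Longrightarrow> h \<in> D \<Longrightarrow> E h (\<lambda>x. c * f x) = c * E h f"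
  using form_scale[of f h c] by (simp add: form_sym domain_scale)

lemma form_zero: "h \<in> D \<Longrightarrow> E (\<lambda>_. 0) h = 0"
  using form_scale[OF domain_zero, of h 0] by simp

lemma form_sum:
  assumes "finite I" and "\<And>i. i \<in> I \<Longrightarrow> f i \<in> D" and "h \<in> D"
  shows "E (\<lambda>x. \<Sum>i\<in>I. f i x) h = (\<Sum>i\<in>I. E (f i) h)"
  using assms
  by (induction I rule: finite_induct) (auto simp: form_zero form_add domain_sum)

lemma form_sum_right:
  assumes "finite I" and "\<And>i. i \<in> I \<Longrightarrow> f i \<in> D" and "h \<in> D"
  shows "E h (\<lambda>x. \<Sum>i\<in>I. f i x) = (\<Sum>i\<in>I. E h (f i))"
  using form_sum[OF assms] assms by (simp add: form_sym domain_sum)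

lemma form_square_add:
  assumes "f \<in> D" "g \<in> D"
  shows "E (\<lambda>x. f x + s * g x) (\<lambda>x. f x + s * g x) = E f f + 2 * s * E f g + s\<^sup>2 * E g g"
  using assms
  by (simp add: form_add form_add_right form_scale form_scale_right domain_add domain_scale
      form_sym[of g f] power2_eq_square algebra_simps)

lemma form_Cauchy_Schwarz:
  assumes "f \<in> D" "g \<in> D"
  shows "(E f g)\<^sup>2 \<le> E f f * E g g"
proof (rule discriminant_bound)
  show "0 \<le> E f f + 2 * s * E f g + s\<^sup>2 * E g g" for s
    using form_nonneg[OF domain_add[OF assms(1) domain_scale[OF assms(2), of s]]]
    by (simp add: form_square_add[OF assms])
qed (use assms form_nonneg in auto)

text \<open>
  Adding a positive multiple of \<open>k\<close> does not change the unit contraction of \<open>g\<close>, hence cannot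
  decrease the energy: the derivative in direction \<open>k\<close> is non-negative.
\<close>

lemma form_saturated_nonneg:
  assumes g: "g \<in> D" and k: "k \<in> D"
    and range: "\<And>x. 0 \<le> g x \<and> g x \<le> 1 \<and> 0 \<le> k x"
    and saturated: "\<And>x. 0 < k x \<Longrightarrow> g x = 1"
  shows "0 \<le> E g k"
proof -
  have *: "0 \<le> 2 * E g k + s * E k k" if "0 < s" for s
  proof -
    have "min 1 (max 0 (g x + s * k x)) = g x" for x
    proof (cases "k x = 0")
      case True
      with range[of x] show ?thesis by simp
    next
      case False
      with range[of x] have "0 < k x" by simp
      with saturated[of x] \<open>0 < s\<close> show ?thesis by simp
    qed
    then have "E g g \<le> E (\<lambda>x. g x + s * k x) (\<lambda>x. g x + s * k x)"
      using unit_contraction_form[OF domain_add[OF g domain_scale[OF k, of s]]] by simp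
    then have "0 \<le> s * (2 * E g k + s * E k k)"
      by (simp add: form_square_add[OF g k] power2_eq_square algebra_simps)
    then show ?thesis using that by (simp add: zero_le_mult_iff)
  qed
  have "((\<lambda>s. 2 * E g k + s * E k k) \<longlongrightarrow> 2 * E g k + 0 * E k k) (at_right 0)"
    by (intro tendsto_intros)
  moreover have "\<forall>\<^sub>F s in at_right 0. 0 \<le> 2 * E g k + s * E k k"
    using * by (auto simp: eventually_at_filter)
  ultimately show ?thesis
    using tendsto_lowerbound by fastforce
qed

text \<open>
  Closedness gives lower semicontinuity without weak compactness: the infimum of the energy over
  the \<open>L2\<close>-balls around \<open>v\<close> increases as the balls shrink, and the parallelogram identity turns
  almost minimisers into a Cauchy sequence.
\<close>

lemma form_lower_semicontinuous:
  assumes v: "v \<in> L2 M"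
    and approx: "\<And>e. 0 < e \<Longrightarrow> \<exists>w\<in>D. L2_norm M (\<lambda>x. w x - v x) \<le> e \<and> E w w \<le> K + e"
  shows "v \<in> D \<and> E v v \<le> K"
proof -
  define rad where "rad n = inverse (real (Suc n))" for n
  have anti: "rad n \<le> rad m" if "m \<le> n" for m n
    unfolding rad_def using that by (intro le_imp_inverse_le) auto
  have rad_pos: "0 < rad n" and rad_le_1: "rad n \<le> 1" for n
    by (simp_all add: rad_def inverse_le_1_iff)
  have lim0: "rad \<longlonglongrightarrow> 0" unfolding rad_def by (rule LIMSEQ_inverse_real_of_nat)
  define C where "C n = {w \<in> D. L2_norm M (\<lambda>x. w x - v x) \<le> rad n}" for n
  define d where "d n = (INF w\<in>C n. E w w)" for n
  have bdd: "bdd_below ((\<lambda>w. E w w) ` C n)" for n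
    by (rule bdd_belowI[where m = 0]) (auto simp: C_def form_nonneg)
  have small: "\<exists>w\<in>C n. E w w \<le> K + e" if "0 < e" for n e
  proof -
    obtain w where "w \<in> D" "L2_norm M (\<lambda>x. w x - v x) \<le> min e (rad n)"
      "E w w \<le> K + min e (rad n)"
      using approx[of "min e (rad n)"] \<open>0 < e\<close> rad_pos[of n] by auto
    then show ?thesis by (auto simp: C_def)
  qed
  have ne: "C n \<noteq> {}" for n using small[of 1 n] by auto
  have d_le: "d n \<le> E w w" if "w \<in> C n" for w n
    unfolding d_def using that by (intro cINF_lower bdd)
  have d_le_K: "d n \<le> K" for n
  proof (rule field_le_epsilon)
    fix e :: real assume "0 < e"
    with small obtain w where "w \<in> C n" "E w w \<le> K + e" by blast
    with d_le[of w n] show "d n \<le> K + e" by linarith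
  qed
  have d_mono: "d m \<le> d n" if "m \<le> n" for m n
    unfolding d_def
    by (intro cINF_superset_mono ne bdd) (auto simp: C_def intro: order_trans[OF _ anti[OF that]])
  have "\<exists>w\<in>C n. E w w < d n + rad n" for n
    using cINF_less_iff[OF ne bdd, of n "d n + rad n"] rad_pos[of n] by (simp add: d_def)
  then obtain w where wC: "w n \<in> C n" and w_less: "E (w n) (w n) < d n + rad n" for n
    by metis
  have wD: "w n \<in> D" and w_near: "L2_norm M (\<lambda>x. w n x - v x) \<le> rad n" for n
    using wC[of n] by (auto simp: C_def)
  have wL2: "w n \<in> L2 M" for n using wD domain_L2 by auto
  have incr: "incseq d" by (simp add: incseq_def d_mono)
  then obtain d' where "d \<longlonglongrightarrow> d'"
    using incseq_convergent[OF incr, of K] d_le_K by blast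
  then have "Cauchy d" by (rule LIMSEQ_imp_Cauchy)
  have E_diff: "E (\<lambda>x. w m x - w n x) (\<lambda>x. w m x - w n x)
      \<le> 2 * (d n - d m) + 4 * rad m" if "m \<le> n" for m n
  proof -
    let ?s = "\<lambda>x. 1 / 2 * (w m x + w n x)"
    have "?s \<in> C m"
      unfolding C_def
    proof (intro CollectI conjI)
      show "?s \<in> D" using wD by (intro domain_scale domain_add)
      have "L2_norm M (\<lambda>x. ?s x - v x)
          = L2_norm M (\<lambda>x. 1 / 2 * ((w m x - v x) + (w n x - v x)))"
        by (intro arg_cong[where f = "L2_norm M"]) (auto simp: field_simps)
      also have "\<dots> \<le> 1 / 2 * (L2_norm M (\<lambda>x. w m x - v x) + L2_norm M (\<lambda>x. w n x - v x))"
        unfolding L2_norm_scale abs_divide abs_one abs_numeral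
        by (intro mult_left_mono L2_norm_triangle L2_diff wL2 v) simp
      also have "\<dots> \<le> rad m"
        using add_mono[OF w_near[of m] order_trans[OF w_near[of n] anti[OF that]]] by simp
      finally show "L2_norm M (\<lambda>x. ?s x - v x) \<le> rad m" .
    qed
    then have "d m \<le> E ?s ?s" by (rule d_le)
    also have "\<dots> = 1 / 2 * E (\<lambda>x. w m x + w n x) ?s"
      by (intro form_scale domain_add domain_scale wD)
    also have "E (\<lambda>x. w m x + w n x) ?s = 1 / 2 * E (\<lambda>x. w m x + w n x) (\<lambda>x. w m x + w n x)"
      by (intro form_scale_right domain_add wD)
    also have "E (\<lambda>x. w m x + w n x) (\<lambda>x. w m x + w n x)
        = E (w m) (w m) + 2 * E (w m) (w n) + E (w n) (w n)"
      using form_square_add[OF wD wD, of m 1 n] by simp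
    finally have mid: "4 * d m \<le> E (w m) (w m) + 2 * E (w m) (w n) + E (w n) (w n)" by simp
    have "E (\<lambda>x. w m x - w n x) (\<lambda>x. w m x - w n x)
        = E (w m) (w m) - 2 * E (w m) (w n) + E (w n) (w n)"
      using form_square_add[OF wD wD, of m "-1" n] by simp
    also have "\<dots> \<le> 2 * E (w m) (w m) + 2 * E (w n) (w n) - 4 * d m" using mid by linarith
    also have "\<dots> \<le> 2 * (d n - d m) + 4 * rad m"
      using w_less[of m] w_less[of n] anti[OF that] by argo
    finally show ?thesis .
  qed
  have L2_near: "(L2_norm M (\<lambda>x. w m x - w n x))\<^sup>2 \<le> 4 * rad m" if "m \<le> n" for m n
  proof -
    have "L2_norm M (\<lambda>x. w m x - w n x) \<le> 2 * rad m"
      using L2_norm_triangle3[OF wL2[of m] v wL2[of n]] w_near[of m] w_near[of n] anti[OF that]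
        L2_norm_commute[of M v "w n"] by linarith
    then have "(L2_norm M (\<lambda>x. w m x - w n x))\<^sup>2 \<le> (2 * rad m)\<^sup>2"
      by (intro power_mono L2_norm_nonneg)
    also have "\<dots> = 4 * (rad m * rad m)"
      by (simp add: power2_eq_square)
    also have "\<dots> \<le> 4 * (rad m * 1)"
      using rad_pos[of m] rad_le_1[of m] by (intro mult_left_mono) auto
    finally show ?thesis by simp
  qed
  define gap where "gap f g = E (\<lambda>x. f x - g x) (\<lambda>x. f x - g x) + (L2_norm M (\<lambda>x. f x - g x))\<^sup>2"
    for f g :: "'a \<Rightarrow> real"
  have gap_sym: "gap f g = gap g f" if "f \<in> D" "g \<in> D" for f g
    using form_square_add[OF that, of "-1"] form_square_add[OF that(2,1), of "-1"] form_sym[OF that]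
    by (simp add: gap_def L2_norm_commute[of M f g])
  have "\<exists>N. \<forall>m\<ge>N. \<forall>n\<ge>N. gap (w m) (w n) < e" if "0 < e" for e
  proof -
    obtain N1 where N1: "\<And>m n. m \<ge> N1 \<Longrightarrow> n \<ge> N1 \<Longrightarrow> \<bar>d m - d n\<bar> < e / 8"
      using \<open>Cauchy d\<close> \<open>0 < e\<close> unfolding Cauchy_def dist_real_def
      by (metis divide_pos_pos zero_less_numeral)
    obtain N2 where N2: "rad N2 < e / 16"
      using reals_Archimedean[of "e / 16"] \<open>0 < e\<close> by (auto simp: rad_def)
    have *: "gap (w m) (w n) < e" if "m \<ge> max N1 N2" "m \<le> n" for m n
    proof -
      have "\<bar>d n - d m\<bar> < e / 8" using that by (intro N1) auto
      moreover have "rad m \<le> rad N2" using that by (intro anti) auto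
      ultimately show ?thesis
        using E_diff[OF that(2)] L2_near[OF that(2)] N2 \<open>0 < e\<close> unfolding gap_def by argo
    qed
    have "gap (w m) (w n) < e" if "m \<ge> max N1 N2" "n \<ge> max N1 N2" for m n
      using *[of m n] *[of n m] gap_sym[OF wD wD, of m n] that by (cases "m \<le> n") auto
    then show ?thesis by blast
  qed
  then obtain z where z: "z \<in> D" and lim: "(\<lambda>n. gap (w n) z) \<longlonglongrightarrow> 0"
    using form_closed[of w] wD unfolding gap_def by blast
  have zL2: "z \<in> L2 M" using z domain_L2 by auto
  have nn: "0 \<le> E (\<lambda>x. w n x - z x) (\<lambda>x. w n x - z x)" for n
    using domain_diff[OF wD z] by (rule form_nonneg)
  have lim_E: "(\<lambda>n. E (\<lambda>x. w n x - z x) (\<lambda>x. w n x - z x)) \<longlonglongrightarrow> 0"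
    by (rule tendsto_sandwich[OF _ _ tendsto_const lim]) (auto simp: gap_def nn)
  have "(\<lambda>n. (L2_norm M (\<lambda>x. w n x - z x))\<^sup>2) \<longlonglongrightarrow> 0"
    by (rule tendsto_sandwich[OF _ _ tendsto_const lim]) (auto simp: gap_def nn)
  from tendsto_real_sqrt[OF this] have lim_L2: "(\<lambda>n. L2_norm M (\<lambda>x. w n x - z x)) \<longlonglongrightarrow> 0"
    by (simp add: L2_norm_nonneg)
  have "(\<lambda>n. rad n + L2_norm M (\<lambda>x. w n x - z x)) \<longlonglongrightarrow> 0 + 0"
    by (intro tendsto_add lim0 lim_L2)
  moreover have "L2_norm M (\<lambda>x. z x - v x) \<le> rad n + L2_norm M (\<lambda>x. w n x - z x)" for n
    using L2_norm_triangle3[OF zL2 wL2[of n] v] w_near[of n] L2_norm_commute[of M z "w n"]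
    by linarith
  ultimately have "L2_norm M (\<lambda>x. z x - v x) \<le> 0"
    by (intro LIMSEQ_le_const) (auto intro: exI[of _ 0])
  then have "AE x in M. z x - v x = 0"
    using L2_norm_nonneg[of M] by (intro L2_norm_eq_0_AE L2_diff zL2 v) (auto intro: antisym)
  then have zv: "AE x in M. z x = v x" by simp
  have vD: "v \<in> D" by (rule domain_AE_cong[OF z L2_measurable[OF v] zv])
  have "E z z \<le> K"
  proof (rule LIMSEQ_le_const)
    let ?r = "\<lambda>n. E (\<lambda>x. w n x - z x) (\<lambda>x. w n x - z x)"
    have "(\<lambda>n. K + rad n + 2 * sqrt (E z z * ?r n)) \<longlonglongrightarrow> K + 0 + 2 * sqrt (E z z * 0)"
      by (intro tendsto_intros lim0 lim_E)
    then show "(\<lambda>n. K + rad n + 2 * sqrt (E z z * ?r n)) \<longlonglongrightarrow> K" by simp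
    have "E z z \<le> K + rad n + 2 * sqrt (E z z * ?r n)" for n
    proof -
      let ?y = "\<lambda>x. w n x - z x"
      have yD: "?y \<in> D" using domain_diff[OF wD z] .
      have "E (w n) (w n) = E z z + 2 * E z ?y + E ?y ?y"
        using form_square_add[OF z yD, of 1] by simp
      moreover have "\<bar>E z ?y\<bar> \<le> sqrt (E z z * E ?y ?y)"
        using form_Cauchy_Schwarz[OF z yD] by (simp add: real_le_rsqrt)
      ultimately show ?thesis
        using w_less[of n] d_le_K[of n] nn[of n] by linarith
    qed
    then show "\<exists>N. \<forall>n\<ge>N. E z z \<le> K + rad n + 2 * sqrt (E z z * ?r n)" by blast
  qed
  moreover have "E z z = E v v"
    using form_AE_cong[OF z vD z zv] form_AE_cong[OF z vD vD zv] form_sym[OF z vD] by simp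
  ultimately show ?thesis using vD by simp
qed

end

section \<open>The Stroock--Varopoulos inequality\<close>

text \<open>
  The identity is cut into \<open>N\<close> pieces of height \<open>h\<close>: the piece \<open>ramp a h\<close> grows from 0 to 1 on
  \<open>{a..a + h}\<close>, and linear combinations of the pieces are the piecewise linear interpolations.
\<close>

definition ramp :: "real \<Rightarrow> real \<Rightarrow> real \<Rightarrow> real" where
  "ramp a h y = min 1 (max 0 ((y - a) / h))"

definition interpolation :: "real \<Rightarrow> real \<Rightarrow> nat \<Rightarrow> (real \<Rightarrow> real) \<Rightarrow> real \<Rightarrow> real" where
  "interpolation a h N \<theta> y = \<theta> a +
     (\<Sum>i<N. (\<theta> (a + real (Suc i) * h) - \<theta> (a + real i * h)) * ramp (a + real i * h) h y)"

lemma ramp_range: "0 \<le> ramp a h y \<and> ramp a h y \<le> 1"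
  by (simp add: ramp_def)

lemma ramp_measurable [measurable]: "ramp a h \<in> borel_measurable borel"
  unfolding ramp_def[abs_def] by measurable

lemma interpolation_measurable [measurable]: "interpolation a h N \<theta> \<in> borel_measurable borel"
  unfolding interpolation_def[abs_def] by measurable

lemma interpolation_on_piece:
  assumes "0 < h" and "k < N" and "a + real k * h \<le> y" and "y \<le> a + real (Suc k) * h"
  shows "interpolation a h N \<theta> y = \<theta> (a + real k * h) +
     (\<theta> (a + real (Suc k) * h) - \<theta> (a + real k * h)) * ((y - (a + real k * h)) / h)"
proof -
  let ?f = "\<lambda>i. \<theta> (a + real i * h)"
  let ?t = "\<lambda>i. (?f (Suc i) - ?f i) * ramp (a + real i * h) h y"
  have below: "ramp (a + real i * h) h y = 1" if "i < k" for i
  proof -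
    have "real (Suc i) * h \<le> real k * h" using that \<open>0 < h\<close> by (intro mult_right_mono) auto
    then have "h \<le> y - (a + real i * h)" using assms(3) by (simp add: algebra_simps)
    then show ?thesis using \<open>0 < h\<close> by (simp add: ramp_def min_def max_def field_simps)
  qed
  have above: "ramp (a + real i * h) h y = 0" if "k < i" for i
  proof -
    have "real (Suc k) * h \<le> real i * h" using that \<open>0 < h\<close> by (intro mult_right_mono) auto
    then have "y - (a + real i * h) \<le> 0" using assms(4) by simp
    then have "(y - (a + real i * h)) / h \<le> 0" using \<open>0 < h\<close> by (simp add: divide_le_0_iff)
    then show ?thesis by (simp add: ramp_def)
  qed
  have at: "ramp (a + real k * h) h y = (y - (a + real k * h)) / h"
  proof -
    have "0 \<le> (y - (a + real k * h)) / h" using assms by simp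
    moreover have "(y - (a + real k * h)) / h \<le> 1"
      using assms by (simp add: algebra_simps)
    ultimately show ?thesis by (simp add: ramp_def)
  qed
  have "(\<Sum>i<N. ?t i) = (\<Sum>i<Suc k. ?t i)"
    using \<open>k < N\<close> above by (intro sum.mono_neutral_right) auto
  also have "\<dots> = (\<Sum>i<k. ?t i) + ?t k" by (rule sum.lessThan_Suc)
  also have "(\<Sum>i<k. ?t i) = (\<Sum>i<k. ?f (Suc i) - ?f i)" using below by (intro sum.cong) auto
  also have "\<dots> = ?f k - ?f 0" by (rule sum_lessThan_telescope)
  finally show ?thesis by (simp add: interpolation_def at)
qed

lemma piece_exists:
  fixes a h y :: real
  assumes "0 < h" and "0 < N" and "a \<le> y" and "y \<le> a + real N * h"
  obtains k where "k < N" "a + real k * h \<le> y" "y \<le> a + real (Suc k) * h"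
proof (cases "y = a + real N * h")
  case True
  then show ?thesis
    using \<open>0 < N\<close> \<open>0 < h\<close> by (intro that[of "N - 1"]) (auto simp: algebra_simps)
next
  case False
  define k where "k = nat \<lfloor>(y - a) / h\<rfloor>"
  have pos: "0 \<le> (y - a) / h" using assms by simp
  then have k: "real k = of_int \<lfloor>(y - a) / h\<rfloor>" by (simp add: k_def)
  have le: "real k \<le> (y - a) / h" and less: "(y - a) / h < real k + 1" unfolding k by linarith+
  have "(y - a) / h < real N" using False assms by (simp add: field_simps)
  with le have "k < N" by simp
  with le less show ?thesis
    using \<open>0 < h\<close> by (intro that[of k]) (auto simp: field_simps)
qed

lemma interpolation_id:
  assumes "0 < h" and "0 < N" and "a \<le> y" and "y \<le> a + real N * h"
  shows "interpolation a h N (\<lambda>x. x) y = y"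
proof -
  from piece_exists[OF assms] obtain k
    where "k < N" "a + real k * h \<le> y" "y \<le> a + real (Suc k) * h" .
  note * = interpolation_on_piece[OF \<open>0 < h\<close> this, of "\<lambda>x. x"]
  have "(a + real (Suc k) * h) - (a + real k * h) = h" by (simp add: algebra_simps)
  then show ?thesis using \<open>0 < h\<close> unfolding * by simp
qed

lemma interpolation_uniform:
  assumes cont: "continuous_on {a..b} \<theta>" and "a < b" and "0 < e"
  shows "\<exists>N>0. \<forall>m\<ge>N. \<forall>y\<in>{a..b}. \<bar>interpolation a ((b - a) / real m) m \<theta> y - \<theta> y\<bar> \<le> e"
proof -
  have "uniformly_continuous_on {a..b} \<theta>"
    by (rule compact_uniformly_continuous[OF cont]) simp
  then obtain d where "0 < d"
    and d: "\<And>x y. x \<in> {a..b} \<Longrightarrow> y \<in> {a..b} \<Longrightarrow> \<bar>x - y\<bar> < d \<Longrightarrow> \<bar>\<theta> x - \<theta> y\<bar> < e / 2"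
    using \<open>0 < e\<close> unfolding uniformly_continuous_on_def dist_real_def
    by (metis half_gt_zero)
  obtain N where N: "(b - a) / d < real N" using reals_Archimedean2 by blast
  have "0 < (b - a) / d" using \<open>a < b\<close> \<open>0 < d\<close> by simp
  then have "0 < real N" using N by linarith
  then have "0 < N" by simp
  have main: "\<bar>interpolation a ((b - a) / real m) m \<theta> y - \<theta> y\<bar> \<le> e" if "N \<le> m" "y \<in> {a..b}" for m y
  proof -
    define h where "h = (b - a) / real m"
    have "0 < m" using \<open>0 < N\<close> \<open>N \<le> m\<close> by simp
    have "0 < h" using \<open>0 < m\<close> \<open>a < b\<close> by (simp add: h_def)
    have "(b - a) / d < real m" using N \<open>N \<le> m\<close> by linarith
    then have "h < d" using \<open>0 < d\<close> \<open>0 < m\<close> by (simp add: h_def field_simps)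
    have b: "b = a + real m * h" using \<open>0 < m\<close> by (simp add: h_def)
    from piece_exists[OF \<open>0 < h\<close> \<open>0 < m\<close>, of a y] that b obtain k
      where k: "k < m" "a + real k * h \<le> y" "y \<le> a + real (Suc k) * h" by auto
    let ?x = "a + real k * h" and ?z = "a + real (Suc k) * h"
    have "real (Suc k) * h \<le> real m * h" using k(1) \<open>0 < h\<close> by (intro mult_right_mono) auto
    moreover have zx: "?z - ?x = h" by (simp add: algebra_simps)
    moreover have "0 \<le> real k * h" using \<open>0 < h\<close> by simp
    ultimately have mem: "?x \<in> {a..b}" "?z \<in> {a..b}"
      using \<open>0 < h\<close> b unfolding atLeastAtMost_iff by linarith+
    define r where "r = (\<theta> ?z - \<theta> ?x) * ((y - ?x) / h)"
    have "\<bar>\<theta> ?x - \<theta> y\<bar> < e / 2" and "\<bar>\<theta> ?z - \<theta> ?x\<bar> < e / 2"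
      using k zx \<open>h < d\<close> \<open>0 < h\<close> mem that by (intro d; auto)+
    moreover have "\<bar>r\<bar> \<le> \<bar>\<theta> ?z - \<theta> ?x\<bar> * 1"
      unfolding r_def abs_mult using k zx \<open>0 < h\<close> by (intro mult_left_mono) auto
    ultimately have "\<bar>\<theta> ?x - \<theta> y\<bar> < e / 2" "\<bar>r\<bar> < e / 2" by simp_all
    then have "\<bar>\<theta> ?x + r - \<theta> y\<bar> \<le> e" by linarith
    then show ?thesis
      unfolding h_def[symmetric] interpolation_on_piece[OF \<open>0 < h\<close> k] r_def .
  qed
  show ?thesis using \<open>0 < N\<close> main by blast
qed

locale conservative_dirichlet_probability = prob_space M + conservative_dirichlet_form M D E
  for M :: "'a measure" and D E
begin

lemma domain_const: "(\<lambda>_. c) \<in> D"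
  using domain_scale[OF one_in_domain, of c] by simp

lemma form_const: "h \<in> D \<Longrightarrow> E (\<lambda>_. c) h = 0"
  using form_Cauchy_Schwarz[OF one_in_domain, of h] form_scale[OF one_in_domain, of h c]
  by (simp add: form_one)

lemma domain_ramp:
  assumes "u \<in> D" shows "(\<lambda>x. ramp a h (u x)) \<in> D"
proof -
  have "(\<lambda>x. inverse h * (u x - a)) \<in> D"
    by (intro domain_scale domain_diff assms domain_const)
  from unit_contraction_domain[OF this] show ?thesis
    by (simp add: ramp_def divide_inverse mult.commute)
qed

text \<open>A higher piece is positive only where the lower one is saturated.\<close>

lemma form_ramp_nonneg:
  assumes u: "u \<in> D" and "0 < h" and "i < j"
  shows "0 \<le> E (\<lambda>x. ramp (a + real i * h) h (u x)) (\<lambda>x. ramp (a + real j * h) h (u x))"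
proof (rule form_saturated_nonneg)
  fix x
  assume "0 < ramp (a + real j * h) h (u x)"
  then have "0 < u x - (a + real j * h)"
    using \<open>0 < h\<close> by (auto simp: ramp_def less_max_iff_disj zero_less_divide_iff)
  moreover have "real (Suc i) * h \<le> real j * h"
    using \<open>i < j\<close> \<open>0 < h\<close> by (intro mult_right_mono) auto
  ultimately have "h \<le> u x - (a + real i * h)" by (simp add: algebra_simps)
  then show "ramp (a + real i * h) h (u x) = 1"
    using \<open>0 < h\<close> by (simp add: ramp_def min_def max_def field_simps)
qed (use ramp_range in \<open>auto intro: domain_ramp u\<close>)

lemma domain_interpolation:
  assumes "u \<in> D" shows "(\<lambda>x. interpolation a h N \<theta> (u x)) \<in> D"
  unfolding interpolation_def
  by (intro domain_add domain_const domain_sum domain_scale domain_ramp assms) simp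

lemma form_interpolation:
  assumes u: "u \<in> D"
  shows "E (\<lambda>x. interpolation a h N \<theta> (u x)) (\<lambda>x. interpolation a h N \<phi> (u x)) =
    (\<Sum>i<N. \<Sum>j<N. (\<theta> (a + real (Suc i) * h) - \<theta> (a + real i * h)) *
       (\<phi> (a + real (Suc j) * h) - \<phi> (a + real j * h)) *
       E (\<lambda>x. ramp (a + real i * h) h (u x)) (\<lambda>x. ramp (a + real j * h) h (u x)))"
proof -
  note [simp] = domain_const domain_add domain_sum domain_scale domain_ramp[OF u]
    form_const
  have const': "E f (\<lambda>_. c) = 0" if "f \<in> D" for f c
    using form_const[OF that] form_sym[OF that domain_const] by simp
  show ?thesis
    unfolding interpolation_def
    by (simp add: form_add form_add_right form_sum form_sum_right form_scale form_scale_right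
        const' sum_distrib_left sum_distrib_right mult.assoc)
qed

text \<open>
  All entries of the energy matrix of the pieces are non-negative, so that the inequality may be
  proved for the coefficients of each pair of pieces: by the arithmetic-geometric mean, \<open>dt i * dt j\<close>
  is at most \<open>((dt i)\<^sup>2 + (dt j)\<^sup>2) / 2\<close>.
\<close>

lemma form_interpolation_le:
  assumes u: "u \<in> D" and "0 < h" and "0 < N" and "b = a + real N * h"
    and range: "AE x in M. a \<le> u x \<and> u x \<le> b"
    and ineq: "\<And>x y. a \<le> x \<Longrightarrow> x \<le> y \<Longrightarrow> y \<le> b \<Longrightarrow> (\<theta> y - \<theta> x)\<^sup>2 \<le> (\<phi> y - \<phi> x) * (y - x)"
  shows "E (\<lambda>x. interpolation a h N \<theta> (u x)) (\<lambda>x. interpolation a h N \<theta> (u x))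
    \<le> E (\<lambda>x. interpolation a h N \<phi> (u x)) u"
proof -
  define c where "c i = (\<lambda>x. ramp (a + real i * h) h (u x))" for i
  define dt where "dt i = \<theta> (a + real (Suc i) * h) - \<theta> (a + real i * h)" for i
  define dp where "dp i = \<phi> (a + real (Suc i) * h) - \<phi> (a + real i * h)" for i
  have cD: "c i \<in> D" for i unfolding c_def by (rule domain_ramp[OF u])
  have Esym: "E (c i) (c j) = E (c j) (c i)" for i j by (rule form_sym[OF cD cD])
  have Epos: "0 \<le> E (c i) (c j)" for i j
    using form_nonneg[OF cD, of i] form_ramp_nonneg[OF u \<open>0 < h\<close>, of i j a]
      form_ramp_nonneg[OF u \<open>0 < h\<close>, of j i a] Esym[of i j]
    unfolding c_def by (cases i j rule: linorder_cases) auto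
  have step: "(dt i)\<^sup>2 \<le> dp i * h" if "i < N" for i
  proof -
    have "real (Suc i) * h \<le> real N * h" using that \<open>0 < h\<close> by (intro mult_right_mono) auto
    then show ?thesis
      using ineq[of "a + real i * h" "a + real (Suc i) * h"] \<open>0 < h\<close>
      by (simp add: dt_def dp_def assms(4) algebra_simps)
  qed
  have pair: "dt i * dt j \<le> (dp i + dp j) / 2 * h" if "i < N" "j < N" for i j
  proof -
    have "0 \<le> (dt i - dt j)\<^sup>2" by simp
    then have "2 * (dt i * dt j) \<le> (dt i)\<^sup>2 + (dt j)\<^sup>2" by (simp add: power2_diff)
    with step[OF that(1)] step[OF that(2)] show ?thesis by (simp add: algebra_simps)
  qed
  have "E (\<lambda>x. interpolation a h N \<theta> (u x)) (\<lambda>x. interpolation a h N \<theta> (u x))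
      = (\<Sum>i<N. \<Sum>j<N. dt i * dt j * E (c i) (c j))"
    unfolding form_interpolation[OF u] c_def dt_def ..
  also have "\<dots> \<le> (\<Sum>i<N. \<Sum>j<N. (dp i + dp j) / 2 * h * E (c i) (c j))"
    by (intro sum_mono mult_right_mono Epos pair) auto
  also have "\<dots> = (\<Sum>i<N. \<Sum>j<N. dp i * h * E (c i) (c j)) / 2
      + (\<Sum>i<N. \<Sum>j<N. dp j * h * E (c i) (c j)) / 2"
    by (simp add: sum_divide_distrib flip: sum.distrib) (simp add: algebra_simps add_divide_distrib)
  also have "(\<Sum>i<N. \<Sum>j<N. dp j * h * E (c i) (c j)) = (\<Sum>j<N. \<Sum>i<N. dp j * h * E (c i) (c j))"
    by (rule sum.swap)
  also have "\<dots> = (\<Sum>i<N. \<Sum>j<N. dp i * h * E (c i) (c j))"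
    using Esym by (intro sum.cong refl) simp
  also have "(\<Sum>i<N. \<Sum>j<N. dp i * h * E (c i) (c j)) / 2
      + (\<Sum>i<N. \<Sum>j<N. dp i * h * E (c i) (c j)) / 2
      = E (\<lambda>x. interpolation a h N \<phi> (u x)) (\<lambda>x. interpolation a h N (\<lambda>y. y) (u x))"
    unfolding form_interpolation[OF u] c_def dp_def by (simp add: algebra_simps)
  also have "\<dots> = E (\<lambda>x. interpolation a h N (\<lambda>y. y) (u x)) (\<lambda>x. interpolation a h N \<phi> (u x))"
    by (intro form_sym domain_interpolation u)
  also have "\<dots> = E u (\<lambda>x. interpolation a h N \<phi> (u x))"
  proof (intro form_AE_cong domain_interpolation u)
    show "AE x in M. interpolation a h N (\<lambda>y. y) (u x) = u x"
      by (rule eventually_mono[OF range]) (use assms(2-4) in \<open>auto intro: interpolation_id\<close>)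
  qed
  also have "\<dots> = E (\<lambda>x. interpolation a h N \<phi> (u x)) u"
    by (intro form_sym domain_interpolation u)
  finally show ?thesis .
qed

text \<open>
  Interpolations of \<open>\<phi>\<close> converge uniformly, so the right-hand side of the previous lemma
  converges when \<open>E (_) u\<close> is expressed by the operator; lower semicontinuity handles the left-hand
  side and yields membership of \<open>\<theta> (u x)\<close> in the form domain.  By Cauchy--Schwarz, the hypothesis
  on \<open>\<theta>\<close> and \<open>\<phi>\<close> holds in particular when \<open>\<phi>' = \<theta>'\<^sup>2\<close>.
\<close>

lemma Stroock_Varopoulos:
  assumes ug: "(u, g) \<in> form_operator M D E"
    and "a < b" and range: "AE x in M. a \<le> u x \<and> u x \<le> b"
    and \<theta>_cont: "continuous_on {a..b} \<theta>" and \<phi>_cont: "continuous_on {a..b} \<phi>"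
    and \<theta>_meas: "\<theta> \<in> borel_measurable borel" and \<phi>_meas: "\<phi> \<in> borel_measurable borel"
    and ineq: "\<And>x y. a \<le> x \<Longrightarrow> x \<le> y \<Longrightarrow> y \<le> b \<Longrightarrow> (\<theta> y - \<theta> x)\<^sup>2 \<le> (\<phi> y - \<phi> x) * (y - x)"
  shows "(\<lambda>x. \<theta> (u x)) \<in> D \<and> E (\<lambda>x. \<theta> (u x)) (\<lambda>x. \<theta> (u x)) \<le> - (\<integral>x. g x * \<phi> (u x) \<partial>M)"
proof (rule form_lower_semicontinuous)
  have u: "u \<in> D" and g: "g \<in> L2 M" and op: "\<And>h. h \<in> D \<Longrightarrow> E u h = - (\<integral>x. g x * h x \<partial>M)"
    using ug by (auto simp: form_operator_def)
  have um [measurable]: "u \<in> borel_measurable M"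
    using u domain_L2 L2_measurable by blast
  note [measurable] = \<theta>_meas \<phi>_meas
  show "(\<lambda>x. \<theta> (u x)) \<in> L2 M"
    by (rule L2_continuous_composition[OF \<theta>_cont \<theta>_meas um range])
  have \<phi>L2: "(\<lambda>x. \<phi> (u x)) \<in> L2 M"
    by (rule L2_continuous_composition[OF \<phi>_cont \<phi>_meas um range])
  fix e :: real assume "0 < e"
  define e' where "e' = e / (1 + L2_norm M g)"
  have "0 < e'" using \<open>0 < e\<close> L2_norm_nonneg[of M g] by (simp add: e'_def)
  have ge': "L2_norm M g * e' \<le> e"
    using \<open>0 < e\<close> L2_norm_nonneg[of M g] by (simp add: e'_def field_simps)
  from interpolation_uniform[OF \<theta>_cont \<open>a < b\<close> \<open>0 < e\<close>]
  obtain N1 where "0 < N1" and N1: "\<forall>m\<ge>N1. \<forall>y\<in>{a..b}.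
      \<bar>interpolation a ((b - a) / real m) m \<theta> y - \<theta> y\<bar> \<le> e" by blast
  from interpolation_uniform[OF \<phi>_cont \<open>a < b\<close> \<open>0 < e'\<close>]
  obtain N2 where "0 < N2" and N2: "\<forall>m\<ge>N2. \<forall>y\<in>{a..b}.
      \<bar>interpolation a ((b - a) / real m) m \<phi> y - \<phi> y\<bar> \<le> e'" by blast
  define N where "N = max N1 N2"
  define h where "h = (b - a) / real N"
  have "0 < N" using \<open>0 < N1\<close> by (simp add: N_def)
  have "0 < h" "b = a + real N * h" using \<open>a < b\<close> \<open>0 < N\<close> by (auto simp: h_def)
  define w where "w = (\<lambda>x. interpolation a h N \<theta> (u x))"
  define z where "z = (\<lambda>x. interpolation a h N \<phi> (u x))"
  have wD: "w \<in> D" and zD: "z \<in> D" unfolding w_def z_def by (intro domain_interpolation u)+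
  have zL2: "z \<in> L2 M" using zD domain_L2 by auto
  have zm [measurable]: "z \<in> borel_measurable M" and wm [measurable]: "w \<in> borel_measurable M"
    unfolding z_def w_def by measurable
  have "L2_norm M (\<lambda>x. w x - \<theta> (u x)) \<le> e"
  proof (rule L2_norm_le_sup)
    show "AE x in M. \<bar>w x - \<theta> (u x)\<bar> \<le> e"
      by (rule eventually_mono[OF range]) (use N1 in \<open>auto simp: w_def h_def N_def\<close>)
  qed (use \<open>0 < e\<close> in auto)
  moreover have "L2_norm M (\<lambda>x. z x - \<phi> (u x)) \<le> e'"
  proof (rule L2_norm_le_sup)
    show "AE x in M. \<bar>z x - \<phi> (u x)\<bar> \<le> e'"
      by (rule eventually_mono[OF range]) (use N2 in \<open>auto simp: z_def h_def N_def\<close>)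
  qed (use \<open>0 < e'\<close> in auto)
  then have "L2_norm M g * L2_norm M (\<lambda>x. z x - \<phi> (u x)) \<le> e"
    using mult_left_mono[OF _ L2_norm_nonneg[of M g]] ge' by (meson order_trans)
  then have "\<bar>\<integral>x. g x * (z x - \<phi> (u x)) \<partial>M\<bar> \<le> e"
    using L2_Cauchy_Schwarz[OF g L2_diff[OF zL2 \<phi>L2]] by linarith
  then have "- (\<integral>x. g x * z x \<partial>M) \<le> - (\<integral>x. g x * \<phi> (u x) \<partial>M) + e"
    using L2_integrable_mult[OF g zL2] L2_integrable_mult[OF g \<phi>L2]
    by (simp add: right_diff_distrib)
  moreover have "E w w \<le> E z u"
    unfolding w_def z_def
    by (rule form_interpolation_le[OF u \<open>0 < h\<close> \<open>0 < N\<close> \<open>b = a + real N * h\<close> range ineq])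
  moreover have "E z u = - (\<integral>x. g x * z x \<partial>M)"
    using op[OF zD] form_sym[OF zD u] by simp
  ultimately show "\<exists>w\<in>D. L2_norm M (\<lambda>x. w x - \<theta> (u x)) \<le> e \<and>
      E w w \<le> - (\<integral>x. g x * \<phi> (u x) \<partial>M) + e"
    using wD by force
qed

end

section \<open>Derivatives along the semigroup\<close>

text \<open>
  \<open>L2\<close>-differentiability of the path suffices for a nonlinear functional because the quadratic
  remainder integrates to a multiple of the squared \<open>L2\<close>-distance.
\<close>

lemma (in prob_space) integral_along_path_derivative:
  fixes X :: "real \<Rightarrow> 'a \<Rightarrow> real"
  assumes "t \<in> S" and XL2: "\<And>s. s \<in> S \<Longrightarrow> X s \<in> L2 M" and YL2: "Y \<in> L2 M"
    and lim: "((\<lambda>s. L2_norm M (\<lambda>x. (X s x - X t x) / (s - t) - Y x)) \<longlongrightarrow> 0) (at t within S)"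
    and range: "\<And>s. s \<in> S \<Longrightarrow> AE x in M. a \<le> X s x \<and> X s x \<le> b"
    and Fm: "F \<in> borel_measurable borel" and dFm: "dF \<in> borel_measurable borel"
    and F_cont: "continuous_on {a..b} F" and dF_cont: "continuous_on {a..b} dF"
    and remainder: "\<And>x y. a \<le> x \<Longrightarrow> x \<le> b \<Longrightarrow> a \<le> y \<Longrightarrow> y \<le> b \<Longrightarrow>
        \<bar>F y - F x - dF x * (y - x)\<bar> \<le> K * (y - x)\<^sup>2"
  shows "((\<lambda>s. \<integral>x. F (X s x) \<partial>M) has_real_derivative (\<integral>x. dF (X t x) * Y x \<partial>M)) (at t within S)"
proof -
  define W where "W s x = (X s x - X t x) / (s - t)" for s x
  define n where "n s = L2_norm M (\<lambda>x. W s x - Y x)" for s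
  have FL2: "(\<lambda>x. G (X s x)) \<in> L2 M"
    if "s \<in> S" "continuous_on {a..b} G" "G \<in> borel_measurable borel" for G s
    by (rule L2_continuous_composition[OF that(2,3) L2_measurable[OF XL2[OF that(1)]] range[OF that(1)]])
  have WL2: "W s \<in> L2 M" if "s \<in> S" for s
    unfolding W_def[abs_def] by (intro L2_divide L2_diff XL2 that \<open>t \<in> S\<close>)
  have dL2: "(\<lambda>x. dF (X t x)) \<in> L2 M" by (rule FL2[OF \<open>t \<in> S\<close> dF_cont dFm])
  let ?D = "\<integral>x. dF (X t x) * Y x \<partial>M"
  let ?\<Phi> = "\<lambda>s. \<integral>x. F (X s x) \<partial>M"
  have bound: "\<bar>(?\<Phi> s - ?\<Phi> t) / (s - t) - ?D\<bar>
      \<le> L2_norm M (\<lambda>x. dF (X t x)) * n s + \<bar>K\<bar> * \<bar>s - t\<bar> * (n s + L2_norm M Y)\<^sup>2"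
    if s: "s \<in> S" "s \<noteq> t" for s
  proof -
    define R where "R x = (F (X s x) - F (X t x)) / (s - t) - dF (X t x) * W s x" for x
    have int1: "integrable M (\<lambda>x. dF (X t x) * W s x)" "integrable M (\<lambda>x. dF (X t x) * Y x)"
      by (intro L2_integrable_mult dL2 WL2 YL2 s)+
    moreover have int2: "integrable M (\<lambda>x. F (X s x))" "integrable M (\<lambda>x. F (X t x))"
      by (intro L2_integrable FL2 F_cont Fm s \<open>t \<in> S\<close>)+
    ultimately have intR: "integrable M R" unfolding R_def by auto
    have "(?\<Phi> s - ?\<Phi> t) / (s - t) - ?D = (\<integral>x. dF (X t x) * (W s x - Y x) \<partial>M) + (\<integral>x. R x \<partial>M)"
      using int1 int2 by (simp add: R_def right_diff_distrib)
    moreover have "\<bar>\<integral>x. dF (X t x) * (W s x - Y x) \<partial>M\<bar> \<le> L2_norm M (\<lambda>x. dF (X t x)) * n s"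
      unfolding n_def by (intro L2_Cauchy_Schwarz dL2 L2_diff WL2 YL2 s)
    moreover have "\<bar>\<integral>x. R x \<partial>M\<bar> \<le> \<bar>K\<bar> * \<bar>s - t\<bar> * (n s + L2_norm M Y)\<^sup>2"
    proof -
      have cancel: "c * (e\<^sup>2 * w) / e = c * e * w" if "e \<noteq> 0" for c e w :: real
        using that by (simp add: power2_eq_square)
      have "AE x in M. \<bar>R x\<bar> \<le> \<bar>K\<bar> * \<bar>s - t\<bar> * (W s x)\<^sup>2"
        using range[OF s(1)] range[OF \<open>t \<in> S\<close>]
      proof eventually_elim
        case (elim x)
        have "R x = (F (X s x) - F (X t x) - dF (X t x) * (X s x - X t x)) / (s - t)"
          by (simp add: R_def W_def diff_divide_distrib right_diff_distrib)
        then have "\<bar>R x\<bar> = \<bar>F (X s x) - F (X t x) - dF (X t x) * (X s x - X t x)\<bar> / \<bar>s - t\<bar>"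
          by simp
        also have "\<dots> \<le> (\<bar>K\<bar> * (X s x - X t x)\<^sup>2) / \<bar>s - t\<bar>"
          using order_trans[OF remainder[of "X t x" "X s x"]
              mult_right_mono[OF abs_ge_self[of K] zero_le_power2]] elim
          by (intro divide_right_mono) auto
        also have "(X s x - X t x)\<^sup>2 = \<bar>s - t\<bar>\<^sup>2 * (W s x)\<^sup>2"
          using s by (simp add: W_def power_divide)
        also have "\<bar>K\<bar> * (\<bar>s - t\<bar>\<^sup>2 * (W s x)\<^sup>2) / \<bar>s - t\<bar> = \<bar>K\<bar> * \<bar>s - t\<bar> * (W s x)\<^sup>2"
          by (rule cancel) (use s in simp)
        finally show ?case .
      qed
      then have "(\<integral>x. \<bar>R x\<bar> \<partial>M) \<le> (\<integral>x. \<bar>K\<bar> * \<bar>s - t\<bar> * (W s x)\<^sup>2 \<partial>M)"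
        using intR L2_integrable_sq[OF WL2[OF s(1)]] by (intro integral_mono_AE) auto
      also have "\<dots> = \<bar>K\<bar> * \<bar>s - t\<bar> * (L2_norm M (W s))\<^sup>2" by (simp add: L2_norm_square)
      also have "\<dots> \<le> \<bar>K\<bar> * \<bar>s - t\<bar> * (n s + L2_norm M Y)\<^sup>2"
        using L2_norm_triangle[OF L2_diff[OF WL2[OF s(1)] YL2] YL2]
        by (intro mult_left_mono power_mono L2_norm_nonneg) (auto simp: n_def)
      finally show ?thesis using integral_abs_bound[of M R] by linarith
    qed
    ultimately show ?thesis by linarith
  qed
  have n_lim: "(n \<longlongrightarrow> 0) (at t within S)"
    using lim by (simp add: n_def[abs_def] W_def[abs_def])
  have "((\<lambda>s. L2_norm M (\<lambda>x. dF (X t x)) * n s + \<bar>K\<bar> * \<bar>s - t\<bar> * (n s + L2_norm M Y)\<^sup>2)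
      \<longlongrightarrow> L2_norm M (\<lambda>x. dF (X t x)) * 0 + \<bar>K\<bar> * \<bar>t - t\<bar> * (0 + L2_norm M Y)\<^sup>2) (at t within S)"
    by (intro tendsto_intros n_lim)
  then have "((\<lambda>s. L2_norm M (\<lambda>x. dF (X t x)) * n s + \<bar>K\<bar> * \<bar>s - t\<bar> * (n s + L2_norm M Y)\<^sup>2)
      \<longlongrightarrow> 0) (at t within S)" by simp
  moreover have "\<forall>\<^sub>F s in at t within S. norm ((?\<Phi> s - ?\<Phi> t) / (s - t) - ?D)
      \<le> L2_norm M (\<lambda>x. dF (X t x)) * n s + \<bar>K\<bar> * \<bar>s - t\<bar> * (n s + L2_norm M Y)\<^sup>2"
    using bound by (auto simp: eventually_at_filter)
  ultimately have "((\<lambda>s. (?\<Phi> s - ?\<Phi> t) / (s - t) - ?D) \<longlongrightarrow> 0) (at t within S)"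
    by (rule Lim_null_comparison[rotated])
  then show ?thesis
    by (simp add: has_field_derivative_iff LIM_zero_iff)
qed

locale markov_semigroup_probability = prob_space M + markov_semigroup M P
  for M :: "'a measure" and P
begin

lemma semigroup_difference_quotient:
  assumes "0 \<le> t" "u \<in> L2 M" "f \<in> L2 M" "g \<in> L2 M"
  shows "AE x in M. P t (\<lambda>x. (u x - f x) / h - g x) x = (P t u x - P t f x) / h - P t g x"
proof -
  have neg: "(\<lambda>x. - 1 * f x) \<in> L2 M" "(\<lambda>x. - 1 * g x) \<in> L2 M"
    using L2_scale[OF assms(3), of "- 1"] L2_scale[OF assms(4), of "- 1"] by simp_all
  have sum: "(\<lambda>x. u x + - 1 * f x) \<in> L2 M" using assms neg by (intro L2_add)
  have quot: "(\<lambda>x. 1 / h * (u x + - 1 * f x)) \<in> L2 M" using sum by (rule L2_scale)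
  show ?thesis
    using semigroup_add[OF assms(1) quot neg(2)] semigroup_scale[OF assms(1) sum, of "1 / h"]
      semigroup_add[OF assms(1,2) neg(1)] semigroup_scale[OF assms(1,3), of "- 1"]
      semigroup_scale[OF assms(1,4), of "- 1"]
    by eventually_elim simp
qed

lemma semigroup_diff:
  assumes "0 \<le> t" "f \<in> L2 M" "g \<in> L2 M"
  shows "AE x in M. P t (\<lambda>x. f x - g x) x = P t f x - P t g x"
proof -
  have neg: "(\<lambda>x. - 1 * g x) \<in> L2 M"
    using L2_scale[OF assms(3), of "- 1"] by simp
  show ?thesis
    using semigroup_add[OF assms(1,2) neg] semigroup_scale[OF assms(1,3), of "- 1"]
    by eventually_elim simp
qed

lemma forward_quotient_bound:
  assumes "0 \<le> t" "0 < h" and f: "f \<in> L2 M" and g: "g \<in> L2 M"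
  shows "L2_norm M (\<lambda>x. (P (t + h) f x - P t f x) / h - P t g x)
    \<le> L2_norm M (\<lambda>x. (P h f x - f x) / h - g x)"
proof -
  have Ph: "P h f \<in> L2 M" using assms by (simp add: semigroup_L2)
  have w: "(\<lambda>x. (P h f x - f x) / h - g x) \<in> L2 M"
    by (intro L2_diff L2_divide Ph f g)
  have "(\<lambda>x. (P (t + h) f x - P t f x) / h - P t g x) \<in> borel_measurable M"
    using assms by (intro L2_measurable L2_diff L2_divide semigroup_L2) auto
  then have "L2_norm M (\<lambda>x. (P (t + h) f x - P t f x) / h - P t g x)
      = L2_norm M (P t (\<lambda>x. (P h f x - f x) / h - g x))"
  proof (rule L2_norm_AE_cong)
    show "P t (\<lambda>x. (P h f x - f x) / h - g x) \<in> borel_measurable M"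
      using assms w by (intro L2_measurable semigroup_L2)
    show "AE x in M. (P (t + h) f x - P t f x) / h - P t g x = P t (\<lambda>x. (P h f x - f x) / h - g x) x"
      using semigroup_difference_quotient[OF \<open>0 \<le> t\<close> Ph f g, of h]
        semigroup_comp[of t h f, OF \<open>0 \<le> t\<close> _ f] \<open>0 < h\<close>
      by (auto elim: eventually_elim2)
  qed
  also have "\<dots> \<le> L2_norm M (\<lambda>x. (P h f x - f x) / h - g x)"
    by (rule semigroup_contraction[OF \<open>0 \<le> t\<close> w])
  finally show ?thesis .
qed

lemma backward_quotient_bound:
  assumes "0 \<le> s" "0 < h" and f: "f \<in> L2 M" and g: "g \<in> L2 M"
  shows "L2_norm M (\<lambda>x. (P (s + h) f x - P s f x) / h - P (s + h) g x)
    \<le> L2_norm M (\<lambda>x. (P h f x - f x) / h - g x) + L2_norm M (\<lambda>x. P h g x - g x)"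
proof -
  have Pg: "P h g \<in> L2 M" using assms by (simp add: semigroup_L2)
  have d: "(\<lambda>x. g x - P h g x) \<in> L2 M" by (rule L2_diff[OF g Pg])
  have Psg: "P s g \<in> L2 M" "P (s + h) g \<in> L2 M" "P (s + h) f \<in> L2 M" "P s f \<in> L2 M"
    using assms by (simp_all add: semigroup_L2)
  have q: "(\<lambda>x. (P (s + h) f x - P s f x) / h) \<in> L2 M"
    by (intro L2_divide L2_diff Psg)
  have "L2_norm M (\<lambda>x. (P (s + h) f x - P s f x) / h - P (s + h) g x)
      \<le> L2_norm M (\<lambda>x. (P (s + h) f x - P s f x) / h - P s g x)
        + L2_norm M (\<lambda>x. P s g x - P (s + h) g x)"
    by (rule L2_norm_triangle3[OF q Psg(1,2)])
  also have "L2_norm M (\<lambda>x. P s g x - P (s + h) g x) = L2_norm M (P s (\<lambda>x. g x - P h g x))"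
  proof (rule L2_norm_AE_cong)
    show "AE x in M. P s g x - P (s + h) g x = P s (\<lambda>x. g x - P h g x) x"
      using semigroup_diff[OF \<open>0 \<le> s\<close> g Pg] semigroup_comp[of s h g, OF \<open>0 \<le> s\<close> _ g] \<open>0 < h\<close>
      by (auto elim: eventually_elim2)
  qed (use Psg d assms in \<open>auto intro!: L2_measurable L2_diff semigroup_L2\<close>)
  also have "\<dots> \<le> L2_norm M (\<lambda>x. P h g x - g x)"
    using semigroup_contraction[OF \<open>0 \<le> s\<close> d] by (simp add: L2_norm_commute[of M g])
  also have "L2_norm M (\<lambda>x. (P (s + h) f x - P s f x) / h - P s g x)
      \<le> L2_norm M (\<lambda>x. (P h f x - f x) / h - g x)"
    by (rule forward_quotient_bound[OF assms])
  finally show ?thesis by simp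
qed

text \<open>
  Difference quotients on either side of \<open>t\<close> are images, under contractions, of the quotient at 0.
  On the left, at \<open>s < t\<close>, the latter yields the derivative \<open>P s g\<close> in place of \<open>P t g\<close>; the
  difference is the image under \<open>P s\<close> of \<open>g - P (t - s) g\<close>, which is small by strong continuity.
\<close>

lemma semigroup_path_derivative:
  assumes fg: "(f, g) \<in> generator M P" and "0 \<le> t"
  shows "((\<lambda>s. L2_norm M (\<lambda>x. (P s f x - P t f x) / (s - t) - P t g x)) \<longlongrightarrow> 0) (at t within {0..})"
proof -
  define q where "q h = L2_norm M (\<lambda>x. (P h f x - f x) / h - g x)" for h
  define k where "k h = L2_norm M (\<lambda>x. P h g x - g x)" for h
  have f: "f \<in> L2 M" and g: "g \<in> L2 M" and q_lim: "(q \<longlongrightarrow> 0) (at_right 0)"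
    using fg by (auto simp: generator_def q_def[abs_def])
  have k_lim: "(k \<longlongrightarrow> 0) (at_right 0)"
    using semigroup_continuous[OF g] by (simp add: k_def[abs_def])
  have "((\<lambda>h. q h + k h) \<longlongrightarrow> 0 + 0) (at_right 0)" by (intro tendsto_intros q_lim k_lim)
  moreover have "filterlim (\<lambda>s. \<bar>s - t\<bar>) (at_right 0) (at t within {0..})"
  proof -
    have "((\<lambda>s. \<bar>s - t\<bar>) \<longlongrightarrow> \<bar>t - t\<bar>) (at t within {0..})" by (intro tendsto_intros)
    then show ?thesis by (simp add: filterlim_at eventually_at_filter)
  qed
  ultimately have lim: "((\<lambda>s. q \<bar>s - t\<bar> + k \<bar>s - t\<bar>) \<longlongrightarrow> 0) (at t within {0..})"
    using filterlim_compose[of "\<lambda>h. q h + k h"] by force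
  have bound: "L2_norm M (\<lambda>x. (P s f x - P t f x) / (s - t) - P t g x) \<le> q \<bar>s - t\<bar> + k \<bar>s - t\<bar>"
    if "0 \<le> s" "s \<noteq> t" for s
  proof (cases "t < s")
    case True
    then have "0 \<le> k \<bar>s - t\<bar>" by (simp add: k_def L2_norm_nonneg)
    with True show ?thesis
      using forward_quotient_bound[of t "s - t", OF \<open>0 \<le> t\<close> _ f g] by (simp add: q_def)
  next
    case False
    then have "s < t" using that by simp
    moreover have "(P s f x - P t f x) / (s - t) = (P t f x - P s f x) / (t - s)" for x
      by (metis minus_diff_eq minus_divide_divide)
    ultimately show ?thesis
      using backward_quotient_bound[of s "t - s", OF \<open>0 \<le> s\<close> _ f g] by (simp add: q_def k_def)
  qed
  show ?thesis
  proof (rule Lim_null_comparison[OF _ lim])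
    show "\<forall>\<^sub>F s in at t within {0..}. norm (L2_norm M (\<lambda>x. (P s f x - P t f x) / (s - t) - P t g x))
        \<le> q \<bar>s - t\<bar> + k \<bar>s - t\<bar>"
      using bound by (auto simp: eventually_at_filter L2_norm_nonneg)
  qed
qed

lemma semigroup_generator:
  assumes fg: "(f, g) \<in> generator M P" and "0 \<le> t"
  shows "(P t f, P t g) \<in> generator M P"
proof -
  have f: "f \<in> L2 M" and g: "g \<in> L2 M"
    and lim: "((\<lambda>h. L2_norm M (\<lambda>x. (P h f x - f x) / h - g x)) \<longlongrightarrow> 0) (at_right 0)"
    using fg by (auto simp: generator_def)
  have "((\<lambda>h. L2_norm M (\<lambda>x. (P h (P t f) x - P t f x) / h - P t g x)) \<longlongrightarrow> 0) (at_right 0)"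
  proof (rule Lim_null_comparison[OF _ lim])
    have "L2_norm M (\<lambda>x. (P h (P t f) x - P t f x) / h - P t g x)
        \<le> L2_norm M (\<lambda>x. (P h f x - f x) / h - g x)" if "0 < h" for h
    proof -
      have "L2_norm M (\<lambda>x. (P h (P t f) x - P t f x) / h - P t g x)
          = L2_norm M (\<lambda>x. (P (t + h) f x - P t f x) / h - P t g x)"
      proof (rule L2_norm_AE_cong)
        show "AE x in M. (P h (P t f) x - P t f x) / h - P t g x = (P (t + h) f x - P t f x) / h - P t g x"
          using semigroup_comp[of h t f] f \<open>0 \<le> t\<close> that by (auto simp: add.commute)
      qed (use f g \<open>0 \<le> t\<close> that in
          \<open>auto intro!: L2_measurable L2_diff L2_divide semigroup_L2\<close>)
      with forward_quotient_bound[OF \<open>0 \<le> t\<close> that f g] show ?thesis by simp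
    qed
    then show "\<forall>\<^sub>F h in at_right 0. norm (L2_norm M (\<lambda>x. (P h (P t f) x - P t f x) / h - P t g x))
        \<le> L2_norm M (\<lambda>x. (P h f x - f x) / h - g x)"
      by (auto simp: eventually_at_filter L2_norm_nonneg)
  qed
  then show ?thesis using f g \<open>0 \<le> t\<close> by (simp add: generator_def semigroup_L2)
qed

lemma semigroup_zero_function: "0 \<le> t \<Longrightarrow> AE x in M. P t (\<lambda>_. 0) x = 0"
  using semigroup_scale[of t "\<lambda>_. 0" 0] L2_const[of 0] by simp

text \<open>
  Uniqueness for the Cauchy problem: the path \<open>P t 1\<close> has derivative \<open>P t 0 = 0\<close>, so its squared
  distance to 1 stays at its initial value.
\<close>

lemma semigroup_one:
  assumes one: "((\<lambda>_. 1), (\<lambda>_. 0)) \<in> generator M P" and "0 \<le> t"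
  shows "AE x in M. P t (\<lambda>_. 1) x = 1"
proof -
  let ?X = "\<lambda>s. P s (\<lambda>_. 1)"
  let ?\<Phi> = "\<lambda>s. \<integral>x. (?X s x - 1)\<^sup>2 \<partial>M"
  have XL2: "?X s \<in> L2 M" if "0 \<le> s" for s by (rule semigroup_L2[OF that L2_const])
  have deriv: "(?\<Phi> has_real_derivative 0) (at s within {0..})" if s: "s \<in> {0..}" for s
  proof -
    have "(?\<Phi> has_real_derivative (\<integral>x. 2 * (?X s x - 1) * P s (\<lambda>_. 0) x \<partial>M)) (at s within {0..})"
    proof (rule integral_along_path_derivative[where a = 0 and b = 1 and K = 1
          and F = "\<lambda>y. (y - 1)\<^sup>2" and dF = "\<lambda>y. 2 * (y - 1)"])
      show "((\<lambda>r. L2_norm M (\<lambda>x. (?X r x - ?X s x) / (r - s) - P s (\<lambda>_. 0) x)) \<longlongrightarrow> 0) (at s within {0..})"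
        using semigroup_path_derivative[OF one, of s] s by simp
      show "AE x in M. 0 \<le> ?X r x \<and> ?X r x \<le> 1" if "r \<in> {0..}" for r
        using semigroup_markovian[of r "\<lambda>_. 1"] L2_const that by simp
      show "\<bar>(y - 1)\<^sup>2 - (x - 1)\<^sup>2 - 2 * (x - 1) * (y - x)\<bar> \<le> 1 * (y - x)\<^sup>2" for x y :: real
      proof -
        have "(y - 1)\<^sup>2 - (x - 1)\<^sup>2 - 2 * (x - 1) * (y - x) = (y - x)\<^sup>2"
          by (simp add: power2_eq_square algebra_simps)
        then show ?thesis by simp
      qed
    qed (use s XL2 semigroup_L2 L2_const in \<open>auto intro!: continuous_intros\<close>)
    also have "(\<integral>x. 2 * (?X s x - 1) * P s (\<lambda>_. 0) x \<partial>M) = 0"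
    proof (rule integral_eq_zero_AE)
      show "AE x in M. 2 * (?X s x - 1) * P s (\<lambda>_. 0) x = 0"
        using semigroup_zero_function[of s] s by auto
    qed
    finally show ?thesis .
  qed
  then have "\<exists>c. \<forall>s\<in>{0..}. ?\<Phi> s = c"
    by (intro has_field_derivative_zero_constant) auto
  then have "?\<Phi> t = ?\<Phi> 0" using \<open>0 \<le> t\<close> by auto
  also have "?\<Phi> 0 = 0"
    using semigroup_zero[OF L2_const[of 1]] by (intro integral_eq_zero_AE) auto
  finally have "L2_norm M (\<lambda>x. ?X t x - 1) = 0" by (simp add: L2_norm_def)
  from L2_norm_eq_0_AE[OF L2_diff[OF XL2[OF \<open>0 \<le> t\<close>] L2_const] this] show ?thesis by simp
qed

lemma semigroup_nonneg:
  assumes "0 \<le> t" "f \<in> L2 M" and range: "AE x in M. 0 \<le> f x \<and> f x \<le> C"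
  shows "AE x in M. 0 \<le> P t f x"
proof -
  have "AE x in M. 0 \<le> 1 / (\<bar>C\<bar> + 1) * f x \<and> 1 / (\<bar>C\<bar> + 1) * f x \<le> 1"
    by (rule eventually_mono[OF range]) (auto simp: field_simps)
  from semigroup_markovian[OF \<open>0 \<le> t\<close> L2_scale[OF \<open>f \<in> L2 M\<close>] this]
  have "AE x in M. 0 \<le> P t (\<lambda>x. 1 / (\<bar>C\<bar> + 1) * f x) x" by auto
  with semigroup_scale[OF assms(1,2), of "1 / (\<bar>C\<bar> + 1)"] show ?thesis
  proof eventually_elim
    case (elim x)
    then have "0 \<le> 1 / (\<bar>C\<bar> + 1) * P t f x" by simp
    then show ?case using abs_ge_zero[of C] by (auto simp: zero_le_divide_iff)
  qed
qed

lemma semigroup_bounds: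
  assumes one: "((\<lambda>_. 1), (\<lambda>_. 0)) \<in> generator M P" and "0 \<le> t" and f: "f \<in> L2 M"
    and range: "AE x in M. m \<le> f x \<and> f x \<le> C"
  shows "AE x in M. m \<le> P t f x \<and> P t f x \<le> C"
proof -
  have const: "AE x in M. P t (\<lambda>_. c) x = c" for c
    using semigroup_scale[OF \<open>0 \<le> t\<close> L2_const[of 1], of c] semigroup_one[OF one \<open>0 \<le> t\<close>]
    by eventually_elim simp
  have "AE x in M. 0 \<le> P t (\<lambda>x. f x - m) x"
    by (rule semigroup_nonneg[OF \<open>0 \<le> t\<close> L2_diff[OF f L2_const], where C = "C - m"])
      (use range in auto)
  moreover have "AE x in M. 0 \<le> P t (\<lambda>x. C - f x) x"
    by (rule semigroup_nonneg[OF \<open>0 \<le> t\<close> L2_diff[OF L2_const f], where C = "C - m"])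
      (use range in auto)
  ultimately show ?thesis
    using semigroup_diff[OF \<open>0 \<le> t\<close> f L2_const[of m]] semigroup_diff[OF \<open>0 \<le> t\<close> L2_const[of C] f]
      const[of m] const[of C]
    by eventually_elim simp
qed

end

locale dirichlet_semigroup =
  conservative_dirichlet_probability M D E + markov_semigroup_probability M P
  for M :: "'a measure" and D E P +
  assumes generator_eq: "generator M P = form_operator M D E"
begin

lemma one_in_generator: "((\<lambda>_. 1), (\<lambda>_. 0)) \<in> generator M P"
  using one_in_domain L2_const[of 0] form_const[of _ 1]
  by (simp add: generator_eq form_operator_def)

lemma integral_generator:
  assumes "(f, g) \<in> generator M P" shows "(\<integral>x. g x \<partial>M) = 0"
proof -
  have "f \<in> D" "E f (\<lambda>_. 1) = - (\<integral>x. g x \<partial>M)"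
    using assms one_in_domain by (auto simp: generator_eq form_operator_def)
  then show ?thesis using form_const[of f 1] form_sym[of f "\<lambda>_. 1"] one_in_domain by simp
qed

lemma generator_shift:
  assumes "(f, g) \<in> generator M P" shows "((\<lambda>x. f x + c), g) \<in> form_operator M D E"
  using assms by (auto simp: generator_eq form_operator_def domain_add domain_const form_add form_const)

lemma integral_semigroup:
  assumes fg: "(f, g) \<in> generator M P" and range: "AE x in M. m \<le> f x \<and> f x \<le> C" and "0 \<le> t"
  shows "(\<integral>x. P t f x \<partial>M) = (\<integral>x. f x \<partial>M)"
proof -
  have f: "f \<in> L2 M" and g: "g \<in> L2 M" using fg by (auto simp: generator_def)
  have "((\<lambda>s. \<integral>x. P s f x \<partial>M) has_real_derivative 0) (at s within {0..})" if s: "s \<in> {0..}" for s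
  proof -
    have "((\<lambda>s. \<integral>x. P s f x \<partial>M) has_real_derivative (\<integral>x. 1 * P s g x \<partial>M)) (at s within {0..})"
    proof (rule integral_along_path_derivative[where a = m and b = C and K = 0 and F = "\<lambda>y. y"
          and dF = "\<lambda>_. 1"])
      show "AE x in M. m \<le> P r f x \<and> P r f x \<le> C" if "r \<in> {0..}" for r
        using that by (intro semigroup_bounds one_in_generator f range) simp
    qed (use s f g semigroup_L2 semigroup_path_derivative[OF fg, of s] in auto)
    also have "(\<integral>x. 1 * P s g x \<partial>M) = 0"
      using integral_generator[OF semigroup_generator[OF fg, of s]] s by simp
    finally show ?thesis .
  qed
  then have "\<exists>c. \<forall>s\<in>{0..}. (\<integral>x. P s f x \<partial>M) = c"
    by (intro has_field_derivative_zero_constant) auto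
  then have "(\<integral>x. P t f x \<partial>M) = (\<integral>x. P 0 f x \<partial>M)" using \<open>0 \<le> t\<close> by auto
  also have "\<dots> = (\<integral>x. f x \<partial>M)"
    using semigroup_zero[OF f] f by (intro integral_cong_AE L2_measurable semigroup_L2) auto
  finally show ?thesis .
qed

end

section \<open>The functionals as entropies\<close>

text \<open>
  \<open>Psi M p f\<close> is the Jensen gap of the convex function \<open>Phi p\<close> for the density \<open>f\<^sup>p\<close>.
\<close>

definition Phi :: "real \<Rightarrow> real \<Rightarrow> real" where
  "Phi p y = (if p = 2 then y * ln y / 2 else y powr (2 / p) / (2 - p))"

definition dPhi :: "real \<Rightarrow> real \<Rightarrow> real" where
  "dPhi p y = (if p = 2 then (ln y + 1) / 2 else 2 / p * y powr (2 / p - 1) / (2 - p))"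

lemma Phi_measurable [measurable]: "Phi p \<in> borel_measurable borel"
  unfolding Phi_def[abs_def] by measurable

lemma dPhi_measurable [measurable]: "dPhi p \<in> borel_measurable borel"
  unfolding dPhi_def[abs_def] by measurable

lemma Psi_eq_Jensen_gap:
  assumes "1 \<le> p" "p \<le> 2" and [measurable]: "u \<in> borel_measurable M" and nn: "AE x in M. 0 \<le> u x"
  shows "Psi M p (\<lambda>x. u x powr (1 / p)) = (\<integral>x. Phi p (u x) \<partial>M) - Phi p (\<integral>x. u x \<partial>M)"
proof (cases "p = 2")
  case True
  have sq: "AE x in M. (u x powr (1 / 2))\<^sup>2 = u x"
    using nn by (rule eventually_mono) (simp add: powr_half_sqrt)
  have "(\<integral>x. (u x powr (1 / 2))\<^sup>2 * ln ((u x powr (1 / 2))\<^sup>2) \<partial>M) = (\<integral>x. u x * ln (u x) \<partial>M)"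
    and "(\<integral>x. (u x powr (1 / 2))\<^sup>2 \<partial>M) = (\<integral>x. u x \<partial>M)"
    using sq by (auto intro!: integral_cong_AE)
  then show ?thesis
    using True by (simp add: Psi_def Ent_def Phi_def diff_divide_distrib)
next
  case False
  have "(\<integral>x. (u x powr (1 / p))\<^sup>2 \<partial>M) = (\<integral>x. u x powr (2 / p) \<partial>M)"
    by (intro Bochner_Integration.integral_cong refl) (simp add: power2_eq_square flip: powr_add)
  moreover have "(\<integral>x. (u x powr (1 / p)) powr p \<partial>M) = (\<integral>x. u x \<partial>M)"
  proof (rule integral_cong_AE)
    show "AE x in M. (u x powr (1 / p)) powr p = u x"
      using nn \<open>1 \<le> p\<close> by (auto elim!: eventually_mono simp: powr_powr)
  qed measurable
  ultimately show ?thesis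
    using False by (simp add: Psi_def Phi_def diff_divide_distrib)
qed

lemma Phi_derivative:
  assumes "1 \<le> p" "p \<le> 2" "0 < y"
  shows "(Phi p has_real_derivative dPhi p y) (at y)"
  unfolding Phi_def[abs_def] dPhi_def using assms
  by (cases "p = 2") (auto intro!: derivative_eq_intros simp: add_divide_distrib)

text \<open>
  With \<open>\<theta> y = y powr (1 / p)\<close> the second derivative of \<open>Phi p\<close> is \<open>2 * \<theta>'\<^sup>2\<close>, with the same factor for every
  \<open>p\<close>; this is why half of \<open>dPhi p\<close> is the partner of \<open>\<theta>\<close> in the Stroock--Varopoulos inequality.
\<close>

lemma dPhi_derivative:
  assumes "1 \<le> p" "p \<le> 2" "0 < y"
  shows "(dPhi p has_real_derivative 2 * (1 / p * y powr (1 / p - 1))\<^sup>2) (at y)"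
proof -
  have sq: "(1 / p * y powr (1 / p - 1))\<^sup>2 = 1 / p\<^sup>2 * y powr (2 / p - 2)"
    by (simp add: power_mult_distrib power_divide power2_eq_square flip: powr_add)
  show ?thesis
  proof (cases "p = 2")
    case True
    have "(dPhi p has_real_derivative 1 / y / 2) (at y)"
      unfolding dPhi_def[abs_def] using True \<open>0 < y\<close>
      by (auto intro!: derivative_eq_intros simp: field_simps)
    also have "1 / y / 2 = 2 * (1 / p * y powr (1 / p - 1))\<^sup>2"
      unfolding sq using True \<open>0 < y\<close> by (simp add: powr_minus_divide)
    finally show ?thesis .
  next
    case False
    have "(dPhi p has_real_derivative 2 / p * ((2 / p - 1) * y powr (2 / p - 1 - 1)) / (2 - p)) (at y)"
      unfolding dPhi_def[abs_def] using False assms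
      by (auto intro!: derivative_eq_intros)
    also have "2 / p * ((2 / p - 1) * y powr (2 / p - 1 - 1)) / (2 - p)
        = 2 / p * ((2 / p - 1) / (2 - p)) * y powr (2 / p - 2)" by simp
    also have "(2 / p - 1) / (2 - p) = 1 / p" using False assms by (simp add: field_simps)
    also have "2 / p * (1 / p) * y powr (2 / p - 2) = 2 * (1 / p * y powr (1 / p - 1))\<^sup>2"
      unfolding sq by (simp add: power2_eq_square)
    finally show ?thesis .
  qed
qed

lemma dPhi_difference_bound:
  assumes p: "1 \<le> p" "p \<le> 2" and "0 < x" and "x \<le> y"
  shows "(y powr (1 / p) - x powr (1 / p))\<^sup>2 \<le> (dPhi p y / 2 - dPhi p x / 2) * (y - x)"
proof (cases "x = y")
  case False
  then have "x < y" using \<open>x \<le> y\<close> by simp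
  define l where "l = (y powr (1 / p) - x powr (1 / p)) / (y - x)"
  have l: "y powr (1 / p) - x powr (1 / p) = l * (y - x)" using \<open>x < y\<close> by (simp add: l_def)
  let ?k = "\<lambda>s. l\<^sup>2 * s + dPhi p s / 2 - 2 * l * s powr (1 / p)"
  have "?k x \<le> ?k y"
  proof (rule DERIV_nonneg_imp_nondecreasing[OF \<open>x \<le> y\<close>])
    fix s assume "x \<le> s" "s \<le> y"
    then have "0 < s" using \<open>0 < x\<close> by simp
    \<comment> \<open>The derivative is a square; integrating it is Cauchy--Schwarz with \<open>l\<close> optimal.\<close>
    have "(?k has_real_derivative (l - 1 / p * s powr (1 / p - 1))\<^sup>2) (at s)"
      using \<open>0 < s\<close> p
      by (auto intro!: derivative_eq_intros dPhi_derivative simp: power2_diff)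
    then show "\<exists>d. (?k has_real_derivative d) (at s) \<and> 0 \<le> d" by auto
  qed
  then have "2 * l * (y powr (1 / p) - x powr (1 / p)) \<le> l\<^sup>2 * (y - x) + (dPhi p y / 2 - dPhi p x / 2)"
    by (simp add: algebra_simps)
  then have "l\<^sup>2 * (y - x) \<le> dPhi p y / 2 - dPhi p x / 2"
    unfolding l by (simp add: power2_eq_square algebra_simps)
  then have "l\<^sup>2 * (y - x) * (y - x) \<le> (dPhi p y / 2 - dPhi p x / 2) * (y - x)"
    using \<open>x < y\<close> by (intro mult_right_mono) auto
  then show ?thesis unfolding l by (simp add: power2_eq_square algebra_simps)
qed simp

lemma quadratic_remainder:
  fixes F :: "real \<Rightarrow> real"
  assumes F: "\<And>z. a \<le> z \<Longrightarrow> z \<le> b \<Longrightarrow> (F has_real_derivative dF z) (at z)"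
    and dF: "\<And>z. a \<le> z \<Longrightarrow> z \<le> b \<Longrightarrow> (dF has_real_derivative ddF z) (at z)"
    and C: "\<And>z. a \<le> z \<Longrightarrow> z \<le> b \<Longrightarrow> \<bar>ddF z\<bar> \<le> C" and "0 \<le> C"
    and "a \<le> x" "x \<le> b" "a \<le> y" "y \<le> b"
  shows "\<bar>F y - F x - dF x * (y - x)\<bar> \<le> C * (y - x)\<^sup>2"
proof -
  have seg: "a \<le> z \<and> z \<le> b \<and> \<bar>z - x\<bar> \<le> \<bar>y - x\<bar>" if "z \<in> closed_segment x y" for z
    using that assms(5-8) by (auto simp: closed_segment_eq_real_ivl split: if_splits)
  have lip: "norm (dF z - dF x) \<le> C * norm (z - x)" if "a \<le> z" "z \<le> b" for z
    using that assms
    by (intro field_differentiable_bound[where S = "{a..b}" and f' = ddF])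
       (auto intro: DERIV_subset)
  have "norm ((F y - dF x * y) - (F x - dF x * x)) \<le> C * \<bar>y - x\<bar> * norm (y - x)"
  proof (rule field_differentiable_bound[where S = "closed_segment x y" and f' = "\<lambda>z. dF z - dF x"
        and f = "\<lambda>z. F z - dF x * z"])
    show "((\<lambda>z. F z - dF x * z) has_real_derivative dF z - dF x) (at z within closed_segment x y)"
      if "z \<in> closed_segment x y" for z
      using seg[OF that]
      by (auto intro!: derivative_eq_intros has_field_derivative_at_within[OF F])
    show "norm (dF z - dF x) \<le> C * \<bar>y - x\<bar>" if "z \<in> closed_segment x y" for z
    proof -
      have "norm (dF z - dF x) \<le> C * norm (z - x)" using seg[OF that] by (intro lip) auto
      also have "\<dots> \<le> C * \<bar>y - x\<bar>" using seg[OF that] \<open>0 \<le> C\<close> by (intro mult_left_mono) auto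
      finally show ?thesis .
    qed
  qed auto
  then show ?thesis by (simp add: power2_eq_square algebra_simps flip: abs_mult)
qed

lemma Phi_continuous:
  assumes "1 \<le> p" "p \<le> 2" shows "continuous_on {0..} (Phi p)"
proof (cases "p = 2")
  case True
  have "((\<lambda>y::real. y * ln y / 2) \<longlongrightarrow> 0) (at_right 0)" by real_asymp
  then have "((\<lambda>y::real. y * ln y / 2) \<longlongrightarrow> 0 * ln 0 / 2) (at 0 within {0..})"
    by (simp add: at_within_Ici_at_right)
  moreover have "((\<lambda>y::real. y * ln y / 2) \<longlongrightarrow> y * ln y / 2) (at y within {0..})" if "0 < y" for y
    using that by (intro tendsto_intros) auto
  ultimately show ?thesis
    unfolding Phi_def[abs_def] continuous_on_def using True by (auto simp: le_less)
next
  case False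
  then show ?thesis
    unfolding Phi_def[abs_def] using assms
    by (auto intro!: continuous_on_divide continuous_on_powr' continuous_on_id continuous_on_const)
qed

section \<open>The essential oscillation\<close>

lemma (in prob_space) Osc_attained:
  assumes meas [measurable]: "f \<in> borel_measurable M" and "ess_bounded M f"
  shows "\<exists>a b. (AE x in M. a \<le> f x \<and> f x \<le> b) \<and> Osc M f = b - a \<and> a \<le> b \<and>
    (\<forall>c. (AE x in M. c \<le> f x) \<longrightarrow> c \<le> a) \<and> (\<forall>c. (AE x in M. f x \<le> c) \<longrightarrow> b \<le> c)"
proof -
  obtain C where C: "AE x in M. \<bar>f x\<bar> \<le> C" using assms(2) by (auto simp: ess_bounded_def)
  let ?f = "\<lambda>x. ereal (f x)"
  have m: "?f \<in> borel_measurable M" by measurable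
  have nb: "ae_filter M \<noteq> bot" by (simp add: ae_filter_eq_bot_iff emeasure_space_1)
  have upper: "esssup M ?f \<le> ereal c" if "AE x in M. f x \<le> c" for c
    using that by (intro esssup_I[OF m]) simp
  have lower: "ereal c \<le> essinf M ?f" if "AE x in M. c \<le> f x" for c
    using that m by (auto simp: essinf_def intro!: Liminf_bounded)
  have le: "essinf M ?f \<le> esssup M ?f"
    using m Liminf_le_Limsup[OF nb] by (simp add: essinf_def esssup_def)
  have "AE x in M. f x \<le> C" "AE x in M. - C \<le> f x" using C by auto
  from upper[OF this(1)] lower[OF this(2)] le
  obtain a b where a: "essinf M ?f = ereal a" and b: "esssup M ?f = ereal b"
    by (cases "essinf M ?f"; cases "esssup M ?f") auto
  have "AE x in M. ?f x \<le> esssup M ?f" by (rule esssup_AE)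
  moreover have "AE x in M. essinf M ?f \<le> ?f x"
  proof -
    have "esssup M (\<lambda>x. - ?f x) = Limsup (ae_filter M) (\<lambda>x. - ?f x)"
      unfolding esssup_def by (intro if_P) measurable
    also have "\<dots> = - Liminf (ae_filter M) ?f" by (rule ereal_Limsup_uminus)
    also have "\<dots> = - essinf M ?f" using m by (simp add: essinf_def)
    finally have "AE x in M. - ?f x \<le> - essinf M ?f" using esssup_AE[of "\<lambda>x. - ?f x" M] by simp
    then show ?thesis by (rule eventually_mono) (simp only: ereal_minus_le_minus)
  qed
  ultimately have "AE x in M. a \<le> f x \<and> f x \<le> b" by (simp add: a b)
  then show ?thesis
    using le upper lower by (intro exI[of _ a] exI[of _ b]) (auto simp: a b Osc_def)
qed

lemma (in prob_space) Osc_bounds: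
  assumes "f \<in> borel_measurable M" and range: "AE x in M. a \<le> f x \<and> f x \<le> b"
  shows "0 \<le> Osc M f \<and> Osc M f \<le> b - a"
proof -
  have "ess_bounded M f"
    unfolding ess_bounded_def
    by (intro exI[of _ "max \<bar>a\<bar> \<bar>b\<bar>"] eventually_mono[OF range]) auto
  from Osc_attained[OF assms(1) this] obtain a' b' where
    "Osc M f = b' - a'" "a' \<le> b'" and ext: "\<And>c. AE x in M. c \<le> f x \<Longrightarrow> c \<le> a'"
    "\<And>c. AE x in M. f x \<le> c \<Longrightarrow> b' \<le> c" by blast
  moreover have "a \<le> a'" "b' \<le> b" using range by (auto intro: ext)
  ultimately show ?thesis by simp
qed

section \<open>Integrating the differential inequality\<close>

lemma eta_antimono: "s \<le> t \<Longrightarrow> eta \<alpha> t \<le> eta \<alpha> s"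
  unfolding eta_def by (intro nn_integral_mono) (auto simp: indicator_def)

text \<open>
  After division by \<open>h s\<close>, the hypothesis says formally that \<open>eta \<alpha> \<circ> h\<close> grows at least at rate \<open>c\<close>.  As
  \<open>\<alpha>\<close> is merely measurable, \<open>eta \<alpha>\<close> need not be differentiable at a given point; instead the
  inverse \<open>T\<close> of \<open>h\<close> is recovered from its derivative, which is at most \<open>\<alpha> r / (c * r)\<close> in modulus.
\<close>

lemma eta_lower_bound:
  fixes h h' \<alpha> :: "real \<Rightarrow> real"
  assumes "0 \<le> t" and "0 < c"
    and cont: "continuous_on {0..t} h"
    and pos: "\<And>s. s \<in> {0..t} \<Longrightarrow> 0 < h s"
    and deriv: "\<And>s. s \<in> {0<..<t} \<Longrightarrow> (h has_real_derivative h' s) (at s)"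
    and ineq: "\<And>s. s \<in> {0<..<t} \<Longrightarrow> c * h s \<le> - h' s * \<alpha> (h s)"
    and \<alpha>pos: "\<And>r. 0 < r \<Longrightarrow> 0 < \<alpha> r"
  shows "ennreal (c * t) \<le> eta \<alpha> (h t)"
proof -
  have neg: "h' s < 0" if s: "s \<in> {0<..<t}" for s
  proof -
    have "0 < c * h s" using s pos[of s] \<open>0 < c\<close> by simp
    also have "\<dots> \<le> - h' s * \<alpha> (h s)" by (rule ineq[OF s])
    finally show ?thesis
      using \<alpha>pos[of "h s"] pos[of s] s by (auto simp: zero_less_mult_iff mult_less_0_iff)
  qed
  have less: "h b < h a" if "0 \<le> a" "a < b" "b \<le> t" for a b
  proof (rule DERIV_neg_imp_decreasing_open[OF \<open>a < b\<close>])
    show "continuous_on {a..b} h"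
      by (rule continuous_on_subset[OF cont]) (use that in auto)
    show "\<exists>y. (h has_real_derivative y) (at x) \<and> y < 0" if "a < x" "x < b" for x
      using deriv[of x] neg[of x] that \<open>0 \<le> a\<close> \<open>b \<le> t\<close> by auto
  qed
  have inj: "inj_on h {0..t}"
  proof (rule inj_onI)
    fix x y assume "x \<in> {0..t}" "y \<in> {0..t}" "h x = h y"
    then show "x = y" using less[of x y] less[of y x] by (cases x y rule: linorder_cases) auto
  qed
  have image: "h ` {0..t} = {h t..h 0}"
  proof (rule set_eqI, rule iffI)
    fix r assume "r \<in> h ` {0..t}"
    then obtain s where s: "s \<in> {0..t}" "r = h s" by blast
    then show "r \<in> {h t..h 0}"
      using less[of 0 s] less[of s t] by (cases "s = 0"; cases "s = t") auto
  next
    fix r assume "r \<in> {h t..h 0}"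
    then show "r \<in> h ` {0..t}"
      using IVT2'[of h t r 0] cont \<open>0 \<le> t\<close> by auto
  qed
  define T where "T = the_inv_into {0..t} h"
  have Th: "T (h s) = s" if "s \<in> {0..t}" for s
    using the_inv_into_f_f[OF inj that] by (simp add: T_def)
  have hT: "h (T r) = r" and T_mem: "T r \<in> {0..t}" if "r \<in> {h t..h 0}" for r
    using f_the_inv_into_f[OF inj, of r] the_inv_into_into[OF inj, of r "{0..t}"] that image
    by (auto simp: T_def)
  have T_cont: "continuous_on {h t..h 0} T"
    using continuous_on_inv_into[OF cont _ inj] by (simp add: image T_def)
  have T_open: "T r \<in> {0<..<t}" if r: "r \<in> {h t<..<h 0}" for r
  proof -
    have "T r \<noteq> 0" "T r \<noteq> t" using hT[of r] r by auto
    then show ?thesis using T_mem[of r] r by auto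
  qed
  have T_deriv: "(T has_real_derivative inverse (h' (T r))) (at r)" if r: "r \<in> {h t<..<h 0}" for r
  proof (rule DERIV_inverse_function)
    show "(h has_real_derivative h' (T r)) (at (T r))" by (rule deriv[OF T_open[OF r]])
    show "h' (T r) \<noteq> 0" using neg[OF T_open[OF r]] by simp
    show "h t < r" "r < h 0" using r by auto
    show "h (T y) = y" if "h t < y" "y < h 0" for y using that by (intro hT) auto
    show "isCont T r"
      using continuous_on_interior[OF T_cont, of r] r by simp
  qed
  have "h t \<le> h 0" using less[of 0 t] \<open>0 \<le> t\<close> by (cases "t = 0") auto
  \<comment> \<open>\<open>T\<close> is differentiable everywhere in the interior, so the gauge integral recovers it from
     its derivative although nothing is known about the continuity of the latter.\<close>
  then have "((\<lambda>r. inverse (h' (T r))) has_integral (T (h 0) - T (h t))) {h t..h 0}"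
    using T_cont T_deriv
    by (intro fundamental_theorem_of_calculus_interior)
       (auto simp: has_real_derivative_iff_has_vector_derivative)
  then have "((\<lambda>r. inverse (h' (T r))) has_integral (- t)) {h t..h 0}"
    using Th[of 0] Th[of t] \<open>0 \<le> t\<close> by simp
  from has_integral_mult_right[OF this, of "- c"]
  have "((\<lambda>r. - c * inverse (h' (T r))) has_integral (c * t)) {h t..h 0}"
    by simp
  then have "((\<lambda>r. - c * inverse (h' (T r))) has_integral (c * t)) {h t<..<h 0}"
    by (simp add: has_integral_Icc_iff_Ioo)
  then have "ennreal (c * t)
      = (\<integral>\<^sup>+r. ennreal (- c * inverse (h' (T r))) * indicator {h t<..<h 0} r \<partial>lborel)"
    using neg T_open \<open>0 < c\<close>
    by (intro nn_integral_has_integral_lebesgue'[symmetric])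
       (auto simp: mult_le_0_iff less_imp_le)
  also have "\<dots> \<le> (\<integral>\<^sup>+r. ennreal (\<alpha> r / r) * indicator {h t<..} r \<partial>lborel)"
  proof (intro nn_integral_mono)
    fix r
    show "ennreal (- c * inverse (h' (T r))) * indicator {h t<..<h 0} r
        \<le> ennreal (\<alpha> r / r) * indicator {h t<..} r"
    proof (cases "r \<in> {h t<..<h 0}")
      case True
      have "0 < r" using True pos[of t] \<open>0 \<le> t\<close> by auto
      have "c * r \<le> - h' (T r) * \<alpha> r"
        using ineq[OF T_open[OF True]] hT[of r] True by simp
      then have "- c * inverse (h' (T r)) \<le> \<alpha> r / r"
        using neg[OF T_open[OF True]] \<open>0 < r\<close> by (simp add: field_simps)
      then show ?thesis using True by (auto simp: indicator_def intro: ennreal_leI)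
    qed (auto simp: indicator_def)
  qed
  also have "\<dots> = eta \<alpha> (h t)" by (simp add: eta_def)
  finally show ?thesis .
qed

lemma eta_strict_antimono:
  assumes meas: "\<alpha> \<in> borel_measurable (restrict_space borel {0<..})"
    and \<alpha>pos: "\<And>r. 0 < r \<Longrightarrow> 0 < \<alpha> r"
    and "0 < s" and "s < t" and fin: "eta \<alpha> s < \<infinity>"
  shows "eta \<alpha> t < eta \<alpha> s"
proof -
  have m: "(\<lambda>r. ennreal (\<alpha> r / r) * indicator A r) \<in> borel_measurable lborel"
    if A: "A \<in> sets borel" "A \<subseteq> {0<..}" for A
  proof -
    have 1: "(\<lambda>r. indicator {0<..} r * \<alpha> r) \<in> borel_measurable borel"
      using meas by (simp add: borel_measurable_restrict_space_iff)
    have "(\<lambda>r. ennreal ((indicator {0<..} r * \<alpha> r) / r) * indicator A r) \<in> borel_measurable borel"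
      using 1 A(1) by measurable
    also have "(\<lambda>r. ennreal ((indicator {0<..} r * \<alpha> r) / r) * indicator A r)
        = (\<lambda>r. ennreal (\<alpha> r / r) * indicator A r)"
      using A(2) by (auto simp: fun_eq_iff indicator_def)
    finally show ?thesis by simp
  qed
  let ?g = "\<lambda>r. ennreal (\<alpha> r / r) * indicator {s<..t} r"
  have "eta \<alpha> s = (\<integral>\<^sup>+r. ?g r + ennreal (\<alpha> r / r) * indicator {t<..} r \<partial>lborel)"
    unfolding eta_def using \<open>s < t\<close> by (intro nn_integral_cong) (auto simp: indicator_def)
  also have "\<dots> = (\<integral>\<^sup>+r. ?g r \<partial>lborel) + eta \<alpha> t"
    unfolding eta_def using \<open>0 < s\<close> \<open>s < t\<close> by (intro nn_integral_add m) auto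
  finally have split: "eta \<alpha> s = (\<integral>\<^sup>+r. ?g r \<partial>lborel) + eta \<alpha> t" .
  have "(\<integral>\<^sup>+r. ?g r \<partial>lborel) \<noteq> 0"
  proof
    assume 0: "(\<integral>\<^sup>+r. ?g r \<partial>lborel) = 0"
    have "{s<..t} \<subseteq> {0<..}" using \<open>0 < s\<close> by auto
    then have "?g \<in> borel_measurable lborel" by (intro m) auto
    from iffD1[OF nn_integral_0_iff_AE[OF this] 0] have "AE r in lborel. ?g r = 0" .
    then have "AE r in lborel. r \<notin> {s<..t}"
    proof (rule eventually_mono)
      fix r assume r: "?g r = 0"
      show "r \<notin> {s<..t}"
      proof
        assume "r \<in> {s<..t}"
        with r \<alpha>pos[of r] \<open>0 < s\<close> show False by (simp add: ennreal_eq_0_iff field_simps)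
      qed
    qed
    then have "{s<..t} \<in> null_sets lborel"
      by (subst AE_iff_null_sets) auto
    then show False using \<open>s < t\<close> by (simp add: null_sets_def)
  qed
  moreover have "eta \<alpha> t < \<infinity>"
    using eta_antimono[of s t \<alpha>] fin \<open>s < t\<close> by (simp add: order.strict_trans1)
  ultimately have "eta \<alpha> t + 0 < eta \<alpha> t + (\<integral>\<^sup>+r. ?g r \<partial>lborel)"
    by (simp only: ennreal_add_left_cancel_less) (simp add: zero_less_iff_neq_zero)
  then show ?thesis by (simp only: split add_0_right add.commute[of "eta \<alpha> t"])
qed

lemma eta_small:
  assumes meas: "\<alpha> \<in> borel_measurable (restrict_space borel {0<..})"
    and fin: "eta \<alpha> 1 < \<infinity>" and "0 < u"
  shows "\<exists>s>0. eta \<alpha> s \<le> ennreal u"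
proof -
  have 1: "(\<lambda>r. indicator {0<..} r * \<alpha> r) \<in> borel_measurable borel"
    using meas by (simp add: borel_measurable_restrict_space_iff)
  let ?g = "\<lambda>n r. ennreal (\<alpha> r / r) * indicator {real (Suc n)<..} r"
  have m: "?g n \<in> borel_measurable lborel" for n
  proof -
    have "(\<lambda>r. ennreal ((indicator {0<..} r * \<alpha> r) / r) * indicator {real (Suc n)<..} r)
        \<in> borel_measurable borel"
      using 1 by measurable
    also have "(\<lambda>r. ennreal ((indicator {0<..} r * \<alpha> r) / r) * indicator {real (Suc n)<..} r)
        = ?g n"
      by (auto simp: fun_eq_iff indicator_def)
    finally show ?thesis by simp
  qed
  have "(INF n. \<integral>\<^sup>+r. ?g n r \<partial>lborel) = (\<integral>\<^sup>+r. (INF n. ?g n r) \<partial>lborel)"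
  proof (rule nn_integral_monotone_convergence_INF_decseq[symmetric, where i = 0])
    show "decseq ?g"
    proof (rule decseq_SucI, rule le_funI)
      show "?g (Suc n) r \<le> ?g n r" for n r
        by (rule mult_left_mono) (auto split: split_indicator)
    qed
    show "(\<integral>\<^sup>+r. ?g 0 r \<partial>lborel) < \<infinity>" using fin by (simp add: eta_def)
  qed (rule m)
  also have "(\<lambda>r. INF n. ?g n r) = (\<lambda>r. 0)"
  proof
    fix r
    obtain n where "r < real n" using reals_Archimedean2 by blast
    then have "(INF n. ?g n r) \<le> 0" by (intro order_trans[OF INF_lower[of n]]) auto
    then show "(INF n. ?g n r) = 0" by simp
  qed
  finally have "(INF n. eta \<alpha> (real (Suc n))) = 0"
    by (simp add: eta_def)
  then have "(INF n. eta \<alpha> (real (Suc n))) < ennreal u" using \<open>0 < u\<close> by simp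
  then obtain n where "eta \<alpha> (real (Suc n)) < ennreal u" by (auto simp: INF_less_iff)
  then show ?thesis by (intro exI[of _ "real (Suc n)"]) auto
qed

text \<open>
  A competitor \<open>s < h t\<close> in the infimum would satisfy \<open>eta \<alpha> (h t) < eta \<alpha> s \<le> ennreal (c * t)\<close>,
  against the lower bound; strictness comes from the positivity of \<open>\<alpha>\<close>.
\<close>

lemma decay_le_generalized_inverse:
  fixes h h' \<alpha> :: "real \<Rightarrow> real"
  assumes meas: "\<alpha> \<in> borel_measurable (restrict_space borel {0<..})"
    and \<alpha>pos: "\<And>r. 0 < r \<Longrightarrow> 0 < \<alpha> r"
    and fin: "eta \<alpha> 1 < \<infinity>"
    and "0 < t" and "0 < c"
    and cont: "continuous_on {0..t} h"
    and pos: "\<And>s. s \<in> {0..t} \<Longrightarrow> 0 < h s"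
    and deriv: "\<And>s. s \<in> {0<..<t} \<Longrightarrow> (h has_real_derivative h' s) (at s)"
    and ineq: "\<And>s. s \<in> {0<..<t} \<Longrightarrow> c * h s \<le> - h' s * \<alpha> (h s)"
  shows "h t \<le> generalized_inverse (eta \<alpha>) (c * t)"
  unfolding generalized_inverse_def
proof (rule cInf_greatest)
  show "{s. 0 < s \<and> eta \<alpha> s \<le> ennreal (c * t)} \<noteq> {}"
    using eta_small[OF meas fin, of "c * t"] \<open>0 < t\<close> \<open>0 < c\<close> by auto
next
  fix s assume "s \<in> {s. 0 < s \<and> eta \<alpha> s \<le> ennreal (c * t)}"
  then have s: "0 < s" "eta \<alpha> s \<le> ennreal (c * t)" by auto
  have lb: "ennreal (c * t) \<le> eta \<alpha> (h t)"
    using \<open>0 < t\<close> \<open>0 < c\<close> cont pos deriv ineq \<alpha>pos by (intro eta_lower_bound) auto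
  show "h t \<le> s"
  proof (rule ccontr)
    assume "\<not> h t \<le> s"
    then have "eta \<alpha> (h t) < eta \<alpha> s"
      using s by (intro eta_strict_antimono meas \<alpha>pos)
        (auto intro: order.strict_trans1[OF s(2)])
    with lb s(2) show False by (meson leD order_trans)
  qed
qed

lemma generalized_inverse_nonneg:
  assumes "\<alpha> \<in> borel_measurable (restrict_space borel {0<..})" "eta \<alpha> 1 < \<infinity>" "0 < u"
  shows "0 \<le> generalized_inverse (eta \<alpha>) u"
  unfolding generalized_inverse_def
  using eta_small[OF assms] by (intro cInf_greatest) auto

section \<open>Decay of the entropy\<close>

context dirichlet_semigroup
begin

text \<open>
  Here \<open>a > 0\<close> keeps the path away from 0, where the derivative of \<open>Phi p\<close> may be singular.
  The entropy \<open>\<psi> s\<close> of \<open>P s f\<close> dissipates at rate at least \<open>2 * E (v s) (v s)\<close> with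
  \<open>v s x = P s f x powr (1 / p)\<close>, and the functional inequality bounds this energy from below in
  terms of \<open>\<psi> s\<close> itself, since the range of \<open>v s\<close> does not grow.
\<close>

lemma entropy_decay:
  assumes p: "1 \<le> p" "p \<le> 2"
    and meas: "\<alpha> \<in> borel_measurable (restrict_space borel {0<..})"
    and \<alpha>pos: "\<And>r. 0 < r \<Longrightarrow> 0 < \<alpha> r"
    and fin: "eta \<alpha> 1 < \<infinity>"
    and ineq: "\<And>f r. f \<in> D \<Longrightarrow> ess_bounded M f \<Longrightarrow> AE x in M. 0 \<le> f x \<Longrightarrow> 0 < r \<Longrightarrow>
           Psi M p f \<le> \<alpha> r * E f f + r * (Osc M f)\<^sup>2"
    and fg: "(f, g) \<in> generator M P"
    and "0 < a" "a < b" and range: "AE x in M. a \<le> f x \<and> f x \<le> b"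
    and "0 < t" and \<epsilon>: "0 < \<epsilon>" "\<epsilon> < 1"
  shows "Psi M p (\<lambda>x. P t f x powr (1 / p))
    \<le> 1 / \<epsilon> * generalized_inverse (eta \<alpha>) (2 * (1 - \<epsilon>) * t) * (b powr (1 / p) - a powr (1 / p))\<^sup>2"
proof -
  define \<theta> where "\<theta> y = y powr (1 / p)" for y :: real
  define osc where "osc = \<theta> b - \<theta> a"
  have \<theta>_mono: "\<theta> x \<le> \<theta> y" if "0 \<le> x" "x \<le> y" for x y
    unfolding \<theta>_def using p that by (intro powr_mono2) auto
  have "0 < osc" unfolding osc_def \<theta>_def using p \<open>0 < a\<close> \<open>a < b\<close> by (simp add: powr_less_mono2)
  have f: "f \<in> L2 M" and g: "g \<in> L2 M" using fg by (auto simp: generator_def)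
  have X_L2: "P s f \<in> L2 M" and Y_L2: "P s g \<in> L2 M" if "0 \<le> s" for s
    using semigroup_L2[OF that] f g by auto
  have X_gen: "(P s f, P s g) \<in> generator M P" if "0 \<le> s" for s
    by (rule semigroup_generator[OF fg that])
  have X_range: "AE x in M. a \<le> P s f x \<and> P s f x \<le> b" if "0 \<le> s" for s
    by (rule semigroup_bounds[OF one_in_generator that f range])
  define v where "v s x = \<theta> (P s f x)" for s x
  have v_meas: "v s \<in> borel_measurable M" if "0 \<le> s" for s
    using L2_measurable[OF X_L2[OF that]] unfolding v_def[abs_def] \<theta>_def by measurable
  have v_range: "AE x in M. \<theta> a \<le> v s x \<and> v s x \<le> \<theta> b" if "0 \<le> s" for s
    by (rule eventually_mono[OF X_range[OF that]])
       (use \<open>0 < a\<close> in \<open>auto simp: v_def intro!: \<theta>_mono\<close>)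
  define \<psi> where "\<psi> s = Psi M p (v s)" for s
  define \<psi>' where "\<psi>' s = (\<integral>x. dPhi p (P s f x) * P s g x \<partial>M)" for s
  have \<psi>_eq: "\<psi> s = (\<integral>x. Phi p (P s f x) \<partial>M) - Phi p (\<integral>x. f x \<partial>M)" if "0 \<le> s" for s
  proof -
    have "AE x in M. 0 \<le> P s f x"
      by (rule eventually_mono[OF X_range[OF that]]) (use \<open>0 < a\<close> in auto)
    then show ?thesis
      using Psi_eq_Jensen_gap[OF p L2_measurable[OF X_L2[OF that]]]
        integral_semigroup[OF fg range that]
      by (simp add: \<psi>_def v_def[abs_def] \<theta>_def)
  qed
  have ddPhi_cont: "continuous_on {a..b} (\<lambda>y. 2 * (1 / p * y powr (1 / p - 1))\<^sup>2)"
    using \<open>0 < a\<close> by (intro continuous_intros) auto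
  then obtain K where K: "0 \<le> K"
    "\<And>y. a \<le> y \<Longrightarrow> y \<le> b \<Longrightarrow> \<bar>2 * (1 / p * y powr (1 / p - 1))\<^sup>2\<bar> \<le> K"
    using bounded_on_interval by blast
  have Phi_cont: "continuous_on {a..b} (Phi p)"
    by (rule continuous_at_imp_continuous_on)
       (use \<open>0 < a\<close> in \<open>auto intro: DERIV_isCont[OF Phi_derivative[OF p]]\<close>)
  have dPhi_cont: "continuous_on {a..b} (dPhi p)"
    by (rule continuous_at_imp_continuous_on)
       (use \<open>0 < a\<close> in \<open>auto intro: DERIV_isCont[OF dPhi_derivative[OF p]]\<close>)
  have \<theta>_cont: "continuous_on {a..b} \<theta>"
    unfolding \<theta>_def[abs_def] using \<open>0 < a\<close> by (intro continuous_intros) auto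
  have \<psi>_deriv: "(\<psi> has_real_derivative \<psi>' s) (at s within {0..})" if s: "s \<in> {0..}" for s
  proof -
    have "((\<lambda>s. \<integral>x. Phi p (P s f x) \<partial>M) has_real_derivative \<psi>' s) (at s within {0..})"
      unfolding \<psi>'_def
    proof (rule integral_along_path_derivative[where a = a and b = b and K = K])
      show "((\<lambda>r. L2_norm M (\<lambda>x. (P r f x - P s f x) / (r - s) - P s g x)) \<longlongrightarrow> 0) (at s within {0..})"
        using s by (intro semigroup_path_derivative[OF fg]) simp
      show "\<bar>Phi p y - Phi p x - dPhi p x * (y - x)\<bar> \<le> K * (y - x)\<^sup>2"
        if "a \<le> x" "x \<le> b" "a \<le> y" "y \<le> b" for x y
        using \<open>0 < a\<close> that
        by (intro quadratic_remainder[where a = a and b = b and F = "Phi p" and dF = "dPhi p"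
                and ddF = "\<lambda>z. 2 * (1 / p * z powr (1 / p - 1))\<^sup>2", OF _ _ K(2) K(1)]
              Phi_derivative[OF p] dPhi_derivative[OF p]) auto
    qed (use s X_L2 Y_L2 X_range Phi_cont dPhi_cont in auto)
    then have "((\<lambda>s. (\<integral>x. Phi p (P s f x) \<partial>M) - Phi p (\<integral>x. f x \<partial>M)) has_real_derivative \<psi>' s)
        (at s within {0..})"
      by (auto intro!: derivative_eq_intros)
    then show ?thesis
      using has_field_derivative_transform_within[OF _ zero_less_one s] \<psi>_eq by force
  qed
  have production: "v s \<in> D \<and> E (v s) (v s) \<le> - \<psi>' s / 2" if "0 \<le> s" for s
  proof -
    have "(P s f, P s g) \<in> form_operator M D E" using X_gen[OF that] by (simp add: generator_eq)
    then have "v s \<in> D \<and> E (v s) (v s) \<le> - (\<integral>x. P s g x * (dPhi p (P s f x) / 2) \<partial>M)"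
      unfolding v_def[abs_def]
    proof (rule Stroock_Varopoulos[OF _ \<open>a < b\<close> X_range[OF that] \<theta>_cont])
      show "(\<theta> y - \<theta> x)\<^sup>2 \<le> (dPhi p y / 2 - dPhi p x / 2) * (y - x)" if "a \<le> x" "x \<le> y" for x y
        unfolding \<theta>_def using \<open>0 < a\<close> that by (intro dPhi_difference_bound p) auto
    qed (use dPhi_cont in \<open>auto simp: \<theta>_def[abs_def] intro!: continuous_intros\<close>)
    also have "- (\<integral>x. P s g x * (dPhi p (P s f x) / 2) \<partial>M) = - \<psi>' s / 2"
      by (simp add: \<psi>'_def mult.commute)
    finally show ?thesis .
  qed
  have \<psi>'_nonpos: "\<psi>' s \<le> 0" if "0 \<le> s" for s
    using production[OF that] form_nonneg[of "v s"] by linarith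
  have \<psi>_ineq: "\<psi> s \<le> - \<psi>' s / 2 * \<alpha> r + r * osc\<^sup>2" if "0 \<le> s" "0 < r" for s r
  proof -
    have "ess_bounded M (v s)"
      unfolding ess_bounded_def
      by (intro exI[of _ "max \<bar>\<theta> a\<bar> \<bar>\<theta> b\<bar>"] eventually_mono[OF v_range[OF \<open>0 \<le> s\<close>]]) auto
    moreover have "AE x in M. 0 \<le> v s x" by (simp add: v_def \<theta>_def)
    ultimately have "\<psi> s \<le> \<alpha> r * E (v s) (v s) + r * (Osc M (v s))\<^sup>2"
      unfolding \<psi>_def using production[OF \<open>0 \<le> s\<close>] \<open>0 < r\<close> by (intro ineq) auto
    also have "\<dots> \<le> \<alpha> r * (- \<psi>' s / 2) + r * osc\<^sup>2"
      using Osc_bounds[OF v_meas v_range, OF \<open>0 \<le> s\<close> \<open>0 \<le> s\<close>] production[OF \<open>0 \<le> s\<close>]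
        \<alpha>pos[OF \<open>0 < r\<close>] \<open>0 < r\<close>
      by (intro add_mono mult_left_mono power_mono) (auto simp: osc_def)
    finally show ?thesis by (simp add: mult.commute)
  qed
  have cont: "continuous_on {0..t} \<psi>"
    by (rule continuous_on_subset[OF DERIV_continuous_on[OF \<psi>_deriv]]) auto
  have deriv: "(\<psi> has_real_derivative \<psi>' s) (at s)" if "0 < s" for s
  proof -
    have "(\<psi> has_real_derivative \<psi>' s) (at s within {0<..})"
      by (rule DERIV_subset[OF \<psi>_deriv]) (use that in auto)
    then show ?thesis using at_within_open[of s "{0<..}"] that by simp
  qed
  let ?G = "generalized_inverse (eta \<alpha>) (2 * (1 - \<epsilon>) * t)"
  have "\<psi> t \<le> 1 / \<epsilon> * ?G * osc\<^sup>2"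
  proof (cases "\<psi> t \<le> 0")
    case True
    have "0 \<le> ?G"
      using \<epsilon> \<open>0 < t\<close> by (intro generalized_inverse_nonneg meas fin) simp
    then have "0 \<le> 1 / \<epsilon> * ?G * osc\<^sup>2" using \<epsilon> by simp
    with True show ?thesis by linarith
  next
    case False
    have \<psi>_pos: "0 < \<psi> s" if "s \<in> {0..t}" for s
    proof -
      have "\<psi> t \<le> \<psi> s"
      proof (rule DERIV_nonpos_imp_decreasing_open[where f = \<psi> and a = s and b = t])
        show "continuous_on {s..t} \<psi>" by (rule continuous_on_subset[OF cont]) (use that in auto)
        show "\<exists>y. (\<psi> has_real_derivative y) (at x) \<and> y \<le> 0" if "s < x" "x < t" for x
          using deriv[of x] \<psi>'_nonpos[of x] that \<open>s \<in> {0..t}\<close> by auto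
      qed (use that in auto)
      with False show ?thesis by linarith
    qed
    define k where "k = \<epsilon> / osc\<^sup>2"
    have "0 < k" using \<epsilon> \<open>0 < osc\<close> by (simp add: k_def)
    define h where "h s = k * \<psi> s" for s
    have "h t \<le> generalized_inverse (eta \<alpha>) ((2 * (1 - \<epsilon>)) * t)"
    proof (rule decay_le_generalized_inverse[OF meas \<alpha>pos fin \<open>0 < t\<close>,
          where h' = "\<lambda>s. k * \<psi>' s"])
      show "continuous_on {0..t} h"
        unfolding h_def[abs_def] by (intro continuous_intros cont)
      show h_pos: "0 < h s" if "s \<in> {0..t}" for s
        unfolding h_def using \<psi>_pos[OF that] \<open>0 < k\<close> by simp
      show "(h has_real_derivative k * \<psi>' s) (at s)" if "s \<in> {0<..<t}" for s
        unfolding h_def[abs_def] using deriv[of s] that by (intro DERIV_cmult) auto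
      show "2 * (1 - \<epsilon>) * h s \<le> - (k * \<psi>' s) * \<alpha> (h s)" if "s \<in> {0<..<t}" for s
      proof -
        \<comment> \<open>With \<open>r = h s\<close> the oscillation term is the fraction \<open>\<epsilon>\<close> of the left-hand side.\<close>
        have "\<psi> s \<le> - \<psi>' s / 2 * \<alpha> (h s) + h s * osc\<^sup>2"
          using that by (intro \<psi>_ineq h_pos) auto
        also have "h s * osc\<^sup>2 = \<epsilon> * \<psi> s" using \<open>0 < osc\<close> by (simp add: h_def k_def)
        finally have "2 * (1 - \<epsilon>) * \<psi> s \<le> - \<psi>' s * \<alpha> (h s)" by (simp add: algebra_simps)
        then have "k * (2 * (1 - \<epsilon>) * \<psi> s) \<le> k * (- \<psi>' s * \<alpha> (h s))"
          using \<open>0 < k\<close> by (intro mult_left_mono) auto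
        then show ?thesis by (simp add: h_def algebra_simps)
      qed
    qed (use \<epsilon> in auto)
    then show ?thesis using \<epsilon> \<open>0 < osc\<close> by (simp add: h_def k_def field_simps)
  qed
  then show ?thesis by (simp add: \<psi>_def v_def[abs_def] \<theta>_def osc_def)
qed

end

text \<open>
  Shifting by a positive constant brings a non-negative function into the range of the previous
  lemma; continuity of \<open>Phi p\<close> up to 0 undoes the shift in the limit.
\<close>

lemma (in prob_space) Psi_shift_tendsto:
  assumes p: "1 \<le> p" "p \<le> 2" and [measurable]: "u \<in> borel_measurable M"
    and range: "AE x in M. 0 \<le> u x \<and> u x \<le> C"
    and \<delta>: "\<delta> \<longlonglongrightarrow> 0" "\<And>n. 0 \<le> \<delta> n" "\<And>n. \<delta> n \<le> 1"
  shows "(\<lambda>n. Psi M p (\<lambda>x. (u x + \<delta> n) powr (1 / p))) \<longlonglongrightarrow> Psi M p (\<lambda>x. u x powr (1 / p))"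
proof -
  have u_int: "integrable M u"
    by (rule integrable_const_bound[where B = C]) (use range in auto)
  have mean: "(\<integral>x. u x + d \<partial>M) = (\<integral>x. u x \<partial>M) + d" for d
    using u_int by (simp add: prob_space)
  have mean_nn: "0 \<le> (\<integral>x. u x \<partial>M)"
    by (intro integral_nonneg_AE) (use range in auto)
  have Phi_lim: "(\<lambda>n. Phi p (y + \<delta> n)) \<longlonglongrightarrow> Phi p y" if "0 \<le> y" for y
  proof (rule continuous_on_tendsto_compose[OF Phi_continuous[OF p]])
    show "(\<lambda>n. y + \<delta> n) \<longlonglongrightarrow> y" using tendsto_add[OF tendsto_const \<delta>(1), of y] by simp
  qed (use that \<delta> in auto)
  have "continuous_on {0..C + 1} (Phi p)"
    by (rule continuous_on_subset[OF Phi_continuous[OF p]]) auto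
  then obtain B where B: "\<And>y. 0 \<le> y \<Longrightarrow> y \<le> C + 1 \<Longrightarrow> \<bar>Phi p y\<bar> \<le> B"
    using bounded_on_interval by blast
  have "(\<lambda>n. \<integral>x. Phi p (u x + \<delta> n) \<partial>M) \<longlonglongrightarrow> (\<integral>x. Phi p (u x) \<partial>M)"
  proof (rule integral_dominated_convergence[where w = "\<lambda>_. B"])
    show "AE x in M. (\<lambda>n. Phi p (u x + \<delta> n)) \<longlonglongrightarrow> Phi p (u x)"
      by (rule eventually_mono[OF range]) (auto intro: Phi_lim)
    show "AE x in M. norm (Phi p (u x + \<delta> n)) \<le> B" for n
      by (rule eventually_mono[OF range]) (use \<delta> in \<open>auto intro!: B add_mono\<close>)
  qed auto
  then have "(\<lambda>n. (\<integral>x. Phi p (u x + \<delta> n) \<partial>M) - Phi p ((\<integral>x. u x \<partial>M) + \<delta> n))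
      \<longlonglongrightarrow> (\<integral>x. Phi p (u x) \<partial>M) - Phi p (\<integral>x. u x \<partial>M)"
    by (intro tendsto_diff Phi_lim mean_nn)
  moreover have "Psi M p (\<lambda>x. (u x + \<delta> n) powr (1 / p))
      = (\<integral>x. Phi p (u x + \<delta> n) \<partial>M) - Phi p ((\<integral>x. u x \<partial>M) + \<delta> n)" for n
  proof -
    have "AE x in M. 0 \<le> u x + \<delta> n"
      by (rule eventually_mono[OF range]) (use \<delta>(2)[of n] in auto)
    from Psi_eq_Jensen_gap[OF p _ this] show ?thesis by (simp add: mean)
  qed
  moreover have "Psi M p (\<lambda>x. u x powr (1 / p)) = (\<integral>x. Phi p (u x) \<partial>M) - Phi p (\<integral>x. u x \<partial>M)"
    using range by (intro Psi_eq_Jensen_gap p) auto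
  ultimately show ?thesis by simp
qed

theorem theorem6p2:
  fixes M :: "'a measure"
    and D :: "('a \<Rightarrow> real) set"
    and E :: "('a \<Rightarrow> real) \<Rightarrow> ('a \<Rightarrow> real) \<Rightarrow> real"
    and P :: "real \<Rightarrow> ('a \<Rightarrow> real) \<Rightarrow> ('a \<Rightarrow> real)"
    and p :: real
    and \<alpha> :: "real \<Rightarrow> real"
  assumes "prob_space M"
    and "conservative_dirichlet_form M D E"
    and "associated_markov_semigroup M D E P"
    and "1 \<le> p" and "p \<le> 2"
    and "\<alpha> \<in> borel_measurable (restrict_space borel {0<..})"
    and "\<And>r. 0 < r \<Longrightarrow> 0 < \<alpha> r"
    and "(\<integral>\<^sup>+r\<in>{1<..}. ennreal (\<alpha> r / r) \<partial>lborel) < \<infinity>"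
    and "\<And>f r. f \<in> D \<Longrightarrow> ess_bounded M f \<Longrightarrow> AE x in M. 0 \<le> f x \<Longrightarrow> 0 < r \<Longrightarrow>
           Psi M p f \<le> \<alpha> r * E f f + r * (Osc M f)\<^sup>2"
  shows "\<forall>t>0. \<forall>f\<in>Domain (generator M P). ess_bounded M f \<longrightarrow> (AE x in M. 0 \<le> f x) \<longrightarrow>
           Psi M p (\<lambda>x. P t f x powr (1 / p)) \<le> xi \<alpha> t * (Osc M (\<lambda>x. f x powr (1 / p)))\<^sup>2"
proof (intro allI impI ballI)
  fix t :: real and f
  assume "0 < t" and "f \<in> Domain (generator M P)" and bd: "ess_bounded M f"
    and nn: "AE x in M. 0 \<le> f x"
  interpret dirichlet_semigroup M D E P
    using assms(1-3)
    by (simp add: dirichlet_semigroup_def conservative_dirichlet_probability_def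
        markov_semigroup_probability_def dirichlet_semigroup_axioms_def associated_markov_semigroup_def)
  note p = assms(4,5)
  obtain g where fg: "(f, g) \<in> generator M P" using \<open>f \<in> Domain _\<close> by auto
  have f: "f \<in> L2 M" using fg by (auto simp: generator_def)
  have fm [measurable]: "f \<in> borel_measurable M" using L2_measurable[OF f] .
  let ?w = "\<lambda>x. f x powr (1 / p)"
  have wm: "?w \<in> borel_measurable M" by measurable
  have "ess_bounded M ?w"
  proof -
    obtain C where C: "AE x in M. \<bar>f x\<bar> \<le> C" using bd by (auto simp: ess_bounded_def)
    have "AE x in M. \<bar>?w x\<bar> \<le> C powr (1 / p)"
      using C nn by eventually_elim (use p in \<open>auto intro!: powr_mono2\<close>)
    then show ?thesis by (auto simp: ess_bounded_def)
  qed
  from Osc_attained[OF wm this] obtain a b where w_range: "AE x in M. a \<le> ?w x \<and> ?w x \<le> b"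
    and Osc_eq: "Osc M ?w = b - a" and "a \<le> b"
    and lower: "\<And>c. AE x in M. c \<le> ?w x \<Longrightarrow> c \<le> a" by blast
  have "0 \<le> a" by (rule lower) simp
  define A B where "A = a powr p" and "B = b powr p"
  have "0 \<le> A" "A \<le> B" unfolding A_def B_def using \<open>0 \<le> a\<close> \<open>a \<le> b\<close> p by (auto intro: powr_mono2)
  have root: "A powr (1 / p) = a" "B powr (1 / p) = b"
    using \<open>0 \<le> a\<close> \<open>a \<le> b\<close> p by (simp_all add: A_def B_def powr_powr)
  have range: "AE x in M. A \<le> f x \<and> f x \<le> B"
    using w_range nn
  proof eventually_elim
    case (elim x)
    then have "?w x powr p = f x" using p by (simp add: powr_powr)
    moreover have "a powr p \<le> ?w x powr p" "?w x powr p \<le> b powr p"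
      using elim \<open>0 \<le> a\<close> p by (auto intro!: powr_mono2)
    ultimately show ?case by (simp add: A_def B_def)
  qed
  \<comment> \<open>The range of \<open>f + \<delta> n\<close> is enclosed in \<open>{A + \<delta> n..B + 2 * \<delta> n}\<close>; the second \<open>\<delta> n\<close> makes the
     interval non-degenerate even if \<open>f\<close> is constant.\<close>
  define \<delta> where "\<delta> n = inverse (real (Suc n))" for n
  have \<delta>_lim: "\<delta> \<longlonglongrightarrow> 0" unfolding \<delta>_def by (rule LIMSEQ_inverse_real_of_nat)
  have \<delta>_pos: "0 < \<delta> n" and \<delta>_le: "\<delta> n \<le> 1" for n
    by (simp_all add: \<delta>_def inverse_le_1_iff)
  have \<xi>_bound: "Psi M p (\<lambda>x. P t f x powr (1 / p))
      \<le> 1 / \<epsilon> * generalized_inverse (eta \<alpha>) (2 * (1 - \<epsilon>) * t) * (b - a)\<^sup>2"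
    if \<epsilon>: "\<epsilon> \<in> {0<..<1}" for \<epsilon>
  proof (rule LIMSEQ_le)
    let ?c = "1 / \<epsilon> * generalized_inverse (eta \<alpha>) (2 * (1 - \<epsilon>) * t)"
    let ?O = "\<lambda>n. (B + 2 * \<delta> n) powr (1 / p) - (A + \<delta> n) powr (1 / p)"
    have X_range: "AE x in M. A \<le> P t f x \<and> P t f x \<le> B"
      using \<open>0 < t\<close> by (intro semigroup_bounds[OF one_in_generator _ f range]) simp
    have Xm [measurable]: "P t f \<in> borel_measurable M"
      using \<open>0 < t\<close> by (intro L2_measurable semigroup_L2 f) simp
    show "(\<lambda>n. Psi M p (\<lambda>x. (P t f x + \<delta> n) powr (1 / p))) \<longlonglongrightarrow> Psi M p (\<lambda>x. P t f x powr (1 / p))"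
      by (rule Psi_shift_tendsto[OF p Xm _ \<delta>_lim, where C = B])
         (use X_range \<open>0 \<le> A\<close> \<delta>_pos \<delta>_le in \<open>auto simp: less_imp_le elim!: eventually_mono\<close>)
    have "(\<lambda>n. ?c * (?O n)\<^sup>2) \<longlonglongrightarrow> ?c * ((B + 2 * 0) powr (1 / p) - (A + 0) powr (1 / p))\<^sup>2"
      using \<open>0 \<le> A\<close> \<open>A \<le> B\<close> p \<delta>_pos
      by (intro tendsto_intros tendsto_powr' \<delta>_lim) (auto intro!: always_eventually add_nonneg_nonneg less_imp_le)
    then show "(\<lambda>n. ?c * (?O n)\<^sup>2) \<longlonglongrightarrow> ?c * (b - a)\<^sup>2" by (simp add: root)
    have "Psi M p (\<lambda>x. (P t f x + \<delta> n) powr (1 / p)) \<le> ?c * (?O n)\<^sup>2" for n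
    proof -
      let ?f = "\<lambda>x. f x + \<delta> n"
      have shift: "AE x in M. P t ?f x = P t f x + \<delta> n"
        using semigroup_add[of t f "\<lambda>_. \<delta> n"] semigroup_bounds[OF one_in_generator, of t "\<lambda>_. \<delta> n" "\<delta> n" "\<delta> n"]
          \<open>0 < t\<close> f L2_const by (auto elim: eventually_elim2)
      have "Psi M p (\<lambda>x. P t ?f x powr (1 / p)) \<le> ?c * (?O n)\<^sup>2"
      proof (rule entropy_decay[OF p assms(6,7) _ assms(9), where g = g])
        show "eta \<alpha> 1 < \<infinity>" using assms(8) by (simp add: eta_def)
        show "(?f, g) \<in> generator M P" using generator_shift[OF fg] by (simp add: generator_eq)
        show "AE x in M. A + \<delta> n \<le> ?f x \<and> ?f x \<le> B + 2 * \<delta> n"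
          by (rule eventually_mono[OF range]) (use \<delta>_pos[of n] in auto)
      qed (use \<open>0 \<le> A\<close> \<open>A \<le> B\<close> \<delta>_pos[of n] \<epsilon> \<open>0 < t\<close> in auto)
      moreover have "Psi M p (\<lambda>x. P t ?f x powr (1 / p)) = Psi M p (\<lambda>x. (P t f x + \<delta> n) powr (1 / p))"
      proof -
        have [measurable]: "P t ?f \<in> borel_measurable M"
          using \<open>0 < t\<close> by (intro L2_measurable semigroup_L2 L2_add f L2_const) simp
        have "AE x in M. 0 \<le> P t f x + \<delta> n"
          by (rule eventually_mono[OF X_range]) (use \<open>0 \<le> A\<close> \<delta>_pos[of n] in auto)
        moreover from this shift have "AE x in M. 0 \<le> P t ?f x" by (auto elim: eventually_elim2)
        moreover have "(\<integral>x. Phi p (P t ?f x) \<partial>M) = (\<integral>x. Phi p (P t f x + \<delta> n) \<partial>M)"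
          "(\<integral>x. P t ?f x \<partial>M) = (\<integral>x. P t f x + \<delta> n \<partial>M)"
          using shift by (auto intro!: integral_cong_AE)
        ultimately show ?thesis by (simp add: Psi_eq_Jensen_gap[OF p])
      qed
      ultimately show ?thesis by simp
    qed
    then show "\<exists>N. \<forall>n\<ge>N. Psi M p (\<lambda>x. (P t f x + \<delta> n) powr (1 / p)) \<le> ?c * (?O n)\<^sup>2" by blast
  qed
  show "Psi M p (\<lambda>x. P t f x powr (1 / p)) \<le> xi \<alpha> t * (Osc M ?w)\<^sup>2"
  proof (cases "a = b")
    case True
    then show ?thesis using \<xi>_bound[of "1 / 2"] by (simp add: Osc_eq)
  next
    case False
    then have pos: "0 < (b - a)\<^sup>2" by simp
    have "Psi M p (\<lambda>x. P t f x powr (1 / p)) / (b - a)\<^sup>2 \<le> xi \<alpha> t"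
      unfolding xi_def
      by (rule cINF_greatest) (use \<xi>_bound pos in \<open>auto simp: divide_le_eq\<close>)
    then show ?thesis using pos by (simp add: Osc_eq divide_le_eq)
  qed
qed

end
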